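(* Let $K$ be a field of characteristic zero, let $\mathfrak g$ be a split simple Lie algebra over $K$, and let $\delta=\partial r$ for an $r$-matrix $r\in\mathfrak g\otimes\mathfrak g$ with $r+\kappa(r)=\lambda\Omega$ for some $\lambda\in K^*$. Let $\alpha\in\overline K^*$. Finally let $\mathfrak g'$ be a twisted form of $\mathfrak g$ and $(u_\gamma)$ the corresponding $\mathrm{Gal}(K)$-cocycle. Then $\alpha\overline\delta$ descends to $\mathfrak g'$ (that is, there is a $K$-Lie bialgebra structure $\delta'$ on $\mathfrak g'$ such that $(\mathfrak g'_{\overline K},\delta'_{\overline K})\simeq(\overline{\mathfrak g},\alpha\overline\delta)$ as $\overline K$-Lie bialgebras) if and only if one of the following mutually exclusive conditions holds: (1) $\alpha\in K^*$ and $(u_\gamma\otimes u_\gamma)(r)=r$ for each $\gamma\in\mathrm{Gal}(K)$; (2) $\alpha^2\in K^*\setminus K^{*2}$ and $$(u_\gamma\otimes u_\gamma)(r)=\begin{cases}r&\text{if }\gamma\in\mathrm{Gal}(K(\alpha)),\\ \kappa(r)&\text{if }\gamma(\alpha)=-\alpha.\end{cases}$$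
   Context: $\overline K$ is an algebraic closure of $K$; for $K\subseteq F\subseteq\overline K$, $\mathrm{Gal}(F)=\mathrm{Gal}(\overline K/F)$ is the absolute Galois group of $F$. For a $K$-Lie (bi)algebra, the subscript $\overline K$ denotes scalar extension to $\overline K$; $\overline{\mathfrak g}=\mathfrak g_{\overline K}=\mathfrak g\otimes_K\overline K$ and $\overline\delta=\delta_{\overline K}$. $\kappa$ is the flip $x\otimes y\mapsto y\otimes x$. $\Omega\in\mathfrak g\otimes\mathfrak g$ is the Casimir element, coming from a split simple $\mathbb Q$-Lie algebra $\mathfrak g_0$ with $\mathfrak g=\mathfrak g_0\otimes_{\mathbb Q}K$. An $r$-matrix on $\mathfrak g$ is an element $r\in\mathfrak g\otimes\mathfrak g$ with $\mathrm{CYB}(r)=0$ and $r+\kappa(r)=\lambda\Omega$ for some scalar $\lambda$, where for $r=\sum_is_i\otimes t_i$, $\mathrm{CYB}(r)=\sum_{i,j}([s_i,s_j]\otimes t_i\otimes t_j+s_i\otimes[t_i,s_j]\otimes t_j+s_i\otimes s_j\otimes[t_i,t_j])$. For such $r$, $\partial r(a)=(\mathrm{ad}_a\otimes1+1\otimes\mathrm{ad}_a)(r)$ is a Lie bialgebra structure on $\mathfrak g$. A Lie bialgebra structure on a Lie algebra is a linear map $\delta$ from it to its tensor square which is a Lie cobracket (antisymmetric: $\kappa\circ\delta=-\delta$, and satisfying the co-Jacobi identity) and satisfies $\delta([a,b])=(\mathrm{ad}_a\otimes1+1\otimes\mathrm{ad}_a)\delta(b)-(\mathrm{ad}_b\otimes1+1\otimes\mathrm{ad}_b)\delta(a)$.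 An isomorphism of Lie bialgebras $(\mathfrak a,\delta_1)\to(\mathfrak b,\delta_2)$ is a Lie algebra isomorphism $\phi$ with $(\phi\otimes\phi)\circ\delta_1=\delta_2\circ\phi$. A twisted form of $\mathfrak g$ is a $K$-Lie algebra $\mathfrak g'$ with $\mathfrak g'_{\overline K}\simeq\overline{\mathfrak g}$. A $\mathrm{Gal}(K)$-cocycle is a continuous family $u_\gamma\in\mathrm{Aut}(\overline{\mathfrak g})$ with $u_{\gamma\eta}=u_\gamma\,{}^\gamma u_\eta$, where $\gamma$ acts on $\overline{\mathfrak g}$ through the factor $\overline K$ and ${}^\gamma u=\gamma u\gamma^{-1}$; the twisted form corresponding to it is $\mathfrak g'=\{x\in\overline{\mathfrak g}\mid u_\gamma({}^\gamma x)=x\ \text{for all }\gamma\in\mathrm{Gal}(K)\}$.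
   Formalization: "Descends" is taken with the canonical isomorphism induced by the inclusion of g' in its scalar extension, not an arbitrary one; with an arbitrary isomorphism the "only if" fails, e.g. for sl_2, standard r, alpha = 1 and a nontrivial coboundary cocycle. *)

theory Defs
  imports "HOL-Analysis.Analysis" "HOL-Algebra.Algebraic_Closure_Type"
    "HOL-Algebra.Generated_Fields"
begin

text \<open>
  Finite-dimensional Lie algebras are carried by coordinate spaces \<open>'a^'n\<close> with a bracket, that is,
  they come with a chosen (arbitrary) basis. In these coordinates the tensor product of \<open>'a^'m\<close> and
  \<open>'a^'n\<close> is \<open>'a^('m \<times> 'n)\<close>, the basis vector with index \<open>(i, j)\<close> being the tensor product of the
  \<open>i\<close>-th and the \<open>j\<close>-th basis vector, and the scalar extension of \<open>'a^'n\<close> along a field embedding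
  \<open>h :: 'a \<Rightarrow> 'b\<close> is \<open>'b^'n\<close>.
\<close>

type_synonym ('a, 'n) bracket = "'a^'n \<Rightarrow> 'a^'n \<Rightarrow> 'a^'n"
type_synonym ('a, 'n) cobracket = "'a^'n \<Rightarrow> 'a^('n \<times> 'n)"


section \<open>Tensor products of coordinate spaces\<close>

definition tens :: "'a::field^'m::finite \<Rightarrow> 'a^'n::finite \<Rightarrow> 'a^('m \<times> 'n)" where
  "tens x y = (\<chi> p. x $ fst p * y $ snd p)"

definition tens_map ::
  "('a::field^'m::finite \<Rightarrow> 'a^'p::finite) \<Rightarrow> ('a^'n::finite \<Rightarrow> 'a^'q::finite)
    \<Rightarrow> 'a^('m \<times> 'n) \<Rightarrow> 'a^('p \<times> 'q)" where
  "tens_map f g t = (\<Sum>(i, j)\<in>UNIV. t $ (i, j) *s tens (f (axis i 1)) (g (axis j 1)))"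

definition flip :: "'a::field^('n::finite \<times> 'n) \<Rightarrow> 'a^('n \<times> 'n)" where
  "flip t = (\<chi> p. t $ (snd p, fst p))"

text \<open>The cyclic permutation \<open>x \<otimes> y \<otimes> z \<mapsto> y \<otimes> z \<otimes> x\<close>.\<close>

definition cyc :: "'a::field^('n::finite \<times> 'n \<times> 'n) \<Rightarrow> 'a^('n \<times> 'n \<times> 'n)" where
  "cyc t = (\<chi> p. case p of (i, j, k) \<Rightarrow> t $ (k, i, j))"


section \<open>Lie algebras and Lie bialgebras\<close>

definition lie_algebra :: "('a::field, 'n::finite) bracket \<Rightarrow> bool" where
  "lie_algebra B \<longleftrightarrow>
     (\<forall>x. Vector_Spaces.linear (*s) (*s) (B x)) \<and>
     (\<forall>y. Vector_Spaces.linear (*s) (*s) (\<lambda>x. B x y)) \<and>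
     (\<forall>x. B x x = 0) \<and>
     (\<forall>x y z. B x (B y z) + B y (B z x) + B z (B x y) = 0)"

definition lie_iso ::
  "('a::field, 'm::finite) bracket \<Rightarrow> ('a, 'n::finite) bracket \<Rightarrow> ('a^'m \<Rightarrow> 'a^'n) \<Rightarrow> bool" where
  "lie_iso B1 B2 \<phi> \<longleftrightarrow>
     Vector_Spaces.linear (*s) (*s) \<phi> \<and> bij \<phi> \<and> (\<forall>x y. \<phi> (B1 x y) = B2 (\<phi> x) (\<phi> y))"

definition lie_aut :: "('a::field, 'n::finite) bracket \<Rightarrow> ('a^'n \<Rightarrow> 'a^'n) set" where
  "lie_aut B = {\<phi>. lie_iso B B \<phi>}"

text \<open>The action \<open>ad\<^sub>a \<otimes> 1 + 1 \<otimes> ad\<^sub>a\<close> of a Lie algebra on its tensor square.\<close>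

definition ad2 :: "('a::field, 'n::finite) bracket \<Rightarrow> 'a^'n \<Rightarrow> 'a^('n \<times> 'n) \<Rightarrow> 'a^('n \<times> 'n)" where
  "ad2 B a t = tens_map (B a) id t + tens_map id (B a) t"

definition lie_bialgebra :: "('a::field, 'n::finite) bracket \<Rightarrow> ('a, 'n) cobracket \<Rightarrow> bool" where
  "lie_bialgebra B \<delta> \<longleftrightarrow>
     lie_algebra B \<and>
     Vector_Spaces.linear (*s) (*s) \<delta> \<and>
     (\<forall>x. flip (\<delta> x) = - \<delta> x) \<and>
     (\<forall>x. let t = tens_map id \<delta> (\<delta> x) in t + cyc t + cyc (cyc t) = 0) \<and>
     (\<forall>a b. \<delta> (B a b) = ad2 B a (\<delta> b) - ad2 B b (\<delta> a))"

definition lie_bialgebra_iso ::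
  "('a::field, 'm::finite) bracket \<Rightarrow> ('a, 'm) cobracket \<Rightarrow>
   ('a, 'n::finite) bracket \<Rightarrow> ('a, 'n) cobracket \<Rightarrow> ('a^'m \<Rightarrow> 'a^'n) \<Rightarrow> bool" where
  "lie_bialgebra_iso B1 \<delta>1 B2 \<delta>2 \<phi> \<longleftrightarrow>
     lie_iso B1 B2 \<phi> \<and> (\<forall>x. tens_map \<phi> \<phi> (\<delta>1 x) = \<delta>2 (\<phi> x))"


section \<open>Split simple Lie algebras and the Casimir element\<close>

definition lie_ideal :: "('a::field, 'n::finite) bracket \<Rightarrow> ('a^'n) set \<Rightarrow> bool" where
  "lie_ideal B I \<longleftrightarrow> vec.subspace I \<and> (\<forall>x. \<forall>y\<in>I. B x y \<in> I)"

definition simple_lie_algebra :: "('a::field, 'n::finite) bracket \<Rightarrow> bool" where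
  "simple_lie_algebra B \<longleftrightarrow>
     lie_algebra B \<and> (\<exists>x y. B x y \<noteq> 0) \<and> (\<forall>I. lie_ideal B I \<longrightarrow> I = {0} \<or> I = UNIV)"

primrec lower_central ::
  "('a::field, 'n::finite) bracket \<Rightarrow> ('a^'n) set \<Rightarrow> nat \<Rightarrow> ('a^'n) set" where
  "lower_central B H 0 = H"
| "lower_central B H (Suc k) = vec.span {B x y | x y. x \<in> H \<and> y \<in> lower_central B H k}"

definition cartan_subalgebra :: "('a::field, 'n::finite) bracket \<Rightarrow> ('a^'n) set \<Rightarrow> bool" where
  "cartan_subalgebra B H \<longleftrightarrow>
     vec.subspace H \<and> (\<forall>x\<in>H. \<forall>y\<in>H. B x y \<in> H) \<and>
     (\<exists>k. lower_central B H k = {0}) \<and>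
     {x. \<forall>h\<in>H. B x h \<in> H} = H"

definition diagonalizable :: "('a::field^'n::finite \<Rightarrow> 'a^'n) \<Rightarrow> bool" where
  "diagonalizable f \<longleftrightarrow> vec.span {v. \<exists>c. f v = c *s v} = UNIV"

definition split_simple :: "('a::field, 'n::finite) bracket \<Rightarrow> bool" where
  "split_simple B \<longleftrightarrow>
     simple_lie_algebra B \<and> (\<exists>H. cartan_subalgebra B H \<and> (\<forall>h\<in>H. diagonalizable (B h)))"

definition killing_form :: "('a::field, 'n::finite) bracket \<Rightarrow> 'a^'n \<Rightarrow> 'a^'n \<Rightarrow> 'a" where
  "killing_form B x y = trace (matrix (B x \<circ> B y))"

text \<open>
  \<open>\<Sum>\<^sub>i e\<^sub>i \<otimes> e\<^sup>i\<close> for the basis \<open>e\<^sup>i\<close> dual to the standard basis \<open>e\<^sub>i\<close> with respect to the Killing form: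
  the coordinates of \<open>e\<^sup>i\<close> are given by the inverse of the Gram matrix. Another normalization of the
  invariant form would rescale this element.
\<close>

definition casimir :: "('a::field, 'n::finite) bracket \<Rightarrow> 'a^('n \<times> 'n)" where
  "casimir B =
     (\<chi> p. matrix_inv (\<chi> i j. killing_form B (axis i 1) (axis j 1)) $ fst p $ snd p)"


section \<open>r-matrices\<close>

text \<open>\<open>CYB(r)\<close>, evaluated on \<open>r = \<Sum>\<^sub>i\<^sub>j (r\<^sub>i\<^sub>j e\<^sub>i) \<otimes> e\<^sub>j\<close>.\<close>

definition CYB :: "('a::field, 'n::finite) bracket \<Rightarrow> 'a^('n \<times> 'n) \<Rightarrow> 'a^('n \<times> 'n \<times> 'n)" where
  "CYB B r =
     (\<Sum>(i, j)\<in>UNIV. \<Sum>(k, l)\<in>UNIV.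
        let s = r $ (i, j) *s axis i 1; t = axis j 1; s' = r $ (k, l) *s axis k 1; t' = axis l 1
        in tens (B s s') (tens t t') + tens s (tens (B t s') t') + tens s (tens s' (B t t')))"

definition r_matrix ::
  "('a::field, 'n::finite) bracket \<Rightarrow> 'a^('n \<times> 'n) \<Rightarrow> 'a^('n \<times> 'n) \<Rightarrow> bool" where
  "r_matrix B \<Omega> r \<longleftrightarrow> CYB B r = 0 \<and> (\<exists>c. r + flip r = c *s \<Omega>)"

definition coboundary ::
  "('a::field, 'n::finite) bracket \<Rightarrow> 'a^('n \<times> 'n) \<Rightarrow> ('a, 'n) cobracket" where
  "coboundary B r = (\<lambda>a. ad2 B a r)"


section \<open>Extension of scalars\<close>

definition ext_vec :: "('a \<Rightarrow> 'b) \<Rightarrow> 'a^'n \<Rightarrow> 'b^'n" where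
  "ext_vec h x = (\<chi> i. h (x $ i))"

text \<open>
  Given a map that is semilinear along \<open>h\<close>, the induced linear map on the scalar extension along \<open>h\<close>.
\<close>

definition lin_lift :: "('a::field^'m::finite \<Rightarrow> 'b::field^'n::finite) \<Rightarrow> 'b^'m \<Rightarrow> 'b^'n" where
  "lin_lift f x = (\<Sum>i\<in>UNIV. x $ i *s f (axis i 1))"

definition ext_lin ::
  "('a::field \<Rightarrow> 'b::field) \<Rightarrow> ('a^'m::finite \<Rightarrow> 'a^'n::finite) \<Rightarrow> 'b^'m \<Rightarrow> 'b^'n" where
  "ext_lin h f = lin_lift (ext_vec h \<circ> f)"

definition ext_bracket ::
  "('a::field \<Rightarrow> 'b::field) \<Rightarrow> ('a, 'n::finite) bracket \<Rightarrow> ('b, 'n) bracket" where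
  "ext_bracket h B x y =
     (\<Sum>i\<in>UNIV. \<Sum>j\<in>UNIV. (x $ i * y $ j) *s ext_vec h (B (axis i 1) (axis j 1)))"


section \<open>Absolute Galois groups\<close>

text \<open>
  \<open>K\<close> is the type \<open>'k\<close>, its algebraic closure is \<open>'k alg_closure\<close>, and \<open>K\<close> is embedded in it
  by \<open>to_ac\<close>.
\<close>

definition Gal :: "'k::field alg_closure set \<Rightarrow> ('k alg_closure \<Rightarrow> 'k alg_closure) set" where
  "Gal F = {\<gamma>. bij \<gamma> \<and> (\<forall>x y. \<gamma> (x + y) = \<gamma> x + \<gamma> y) \<and> (\<forall>x y. \<gamma> (x * y) = \<gamma> x * \<gamma> y)
               \<and> (\<forall>x\<in>F. \<gamma> x = x)}"

abbreviation GalK :: "('k::field alg_closure \<Rightarrow> 'k alg_closure) set" where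
  "GalK \<equiv> Gal (range to_ac)"

definition K_adjoin :: "'k::field alg_closure \<Rightarrow> 'k alg_closure set" where
  "K_adjoin a = generate_field ring_of_type_algebra (insert a (range to_ac))"

definition finite_ext :: "'k::field alg_closure set \<Rightarrow> bool" where
  "finite_ext F \<longleftrightarrow>
     subfield F ring_of_type_algebra \<and>
     (\<exists>S. finite S \<and> F = Modules.module.span (\<lambda>c x. to_ac c * x) S)"

definition krull_topology :: "('k::field alg_closure \<Rightarrow> 'k alg_closure) topology" where
  "krull_topology =
     topology_generated_by {{\<gamma> \<circ> \<tau> | \<tau>. \<tau> \<in> Gal F} | \<gamma> F. \<gamma> \<in> GalK \<and> finite_ext F}"

text \<open>
  For \<open>B\<close> over \<open>K\<close>, the group \<open>Gal(K)\<close> acts on \<open>'k alg_closure^'n\<close> by \<open>ext_vec\<close>. Continuity of a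
  cocycle refers to the discrete topology on the automorphism group.
\<close>

definition gal_cocycle ::
  "('k::field, 'n::finite) bracket
    \<Rightarrow> (('k alg_closure \<Rightarrow> 'k alg_closure) \<Rightarrow> 'k alg_closure^'n \<Rightarrow> 'k alg_closure^'n) \<Rightarrow> bool" where
  "gal_cocycle B u \<longleftrightarrow>
     continuous_map krull_topology (discrete_topology (lie_aut (ext_bracket to_ac B))) u \<and>
     (\<forall>\<gamma>\<in>GalK. \<forall>\<eta>\<in>GalK. u (\<gamma> \<circ> \<eta>) = u \<gamma> \<circ> (ext_vec \<gamma> \<circ> u \<eta> \<circ> ext_vec (inv_into UNIV \<gamma>)))"


section \<open>Twisted forms and descent\<close>

definition twisted_form ::
  "('k::field, 'n::finite) bracket \<Rightarrow> ('k, 'm::finite) bracket \<Rightarrow> bool" where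
  "twisted_form B B' \<longleftrightarrow>
     lie_algebra B' \<and> (\<exists>\<phi>. lie_iso (ext_bracket to_ac B') (ext_bracket to_ac B) \<phi>)"

definition twisted_fixed_points ::
  "(('k::field alg_closure \<Rightarrow> 'k alg_closure) \<Rightarrow> 'k alg_closure^'n \<Rightarrow> 'k alg_closure^'n)
    \<Rightarrow> ('k alg_closure^'n) set" where
  "twisted_fixed_points u = {x. \<forall>\<gamma>\<in>GalK. u \<gamma> (ext_vec \<gamma> x) = x}"

text \<open>
  \<open>j\<close> is an isomorphism of \<open>K\<close>-Lie algebras from the Lie algebra with bracket \<open>B'\<close> onto the
  \<open>K\<close>-Lie algebra of twisted fixed points of \<open>u\<close>; in other words, \<open>B'\<close> is the bracket of the latter
  in a \<open>K\<close>-basis, and \<open>j\<close> is the inclusion map in the corresponding coordinates.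
\<close>

definition corresponds ::
  "('k::field, 'n::finite) bracket
    \<Rightarrow> (('k alg_closure \<Rightarrow> 'k alg_closure) \<Rightarrow> 'k alg_closure^'n \<Rightarrow> 'k alg_closure^'n)
    \<Rightarrow> ('k, 'm::finite) bracket \<Rightarrow> ('k^'m \<Rightarrow> 'k alg_closure^'n) \<Rightarrow> bool" where
  "corresponds B u B' j \<longleftrightarrow>
     Vector_Spaces.linear (*s) (\<lambda>c x. to_ac c *s x) j \<and>
     bij_betw j UNIV (twisted_fixed_points u) \<and>
     (\<forall>x y. j (B' x y) = ext_bracket to_ac B (j x) (j y))"

text \<open>
  The isomorphism of scalar extensions is the one induced by the inclusion \<open>j\<close>. It has to be fixed:
  an arbitrary isomorphism would only see the cohomology class of the cocycle, whereas conditions on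
  the values of the cocycle are not invariant under passing to a cohomologous one.
\<close>

definition descends ::
  "('k::field, 'm::finite) bracket \<Rightarrow> ('k^'m \<Rightarrow> 'k alg_closure^'n::finite)
    \<Rightarrow> ('k alg_closure, 'n) bracket \<Rightarrow> ('k alg_closure, 'n) cobracket \<Rightarrow> bool" where
  "descends B' j Bbar \<delta>bar \<longleftrightarrow>
     (\<exists>\<delta>'. lie_bialgebra B' \<delta>' \<and>
        lie_bialgebra_iso (ext_bracket to_ac B') (ext_lin to_ac \<delta>') Bbar \<delta>bar (lin_lift j))"

end

theory Submission
  imports Defs
begin

text \<open>
  The Killing form identifies a tensor with an operator on \<open>\<gg>\<close> in such a way that the Casimir element
  becomes the identity, the flip becomes the adjoint, and an invariant tensor becomes an operator
  commuting with all \<open>ad\<^sub>x\<close>, hence a scalar. An \<open>r\<close>-matrix with \<open>r + \<kappa>(r) = c \<Omega>\<close> becomes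
  \<open>R = S + c / 2\<close> with \<open>S\<close> skew, and the Yang--Baxter equation becomes
  \<open>[S y, S z] = S ([S y, z] + [y, S z]) - (c\<^sup>2 / 4) [y, z]\<close>.

  Since the inclusion of \<open>\<gg>'\<close> extends to an isomorphism over the algebraic closure, \<open>\<alpha> \<delta>\<close>
  descends to \<open>\<gg>'\<close> if and only if it commutes with the twisted Galois action, that is, if and only if
  \<open>\<gamma>(\<alpha>) (u\<^sub>\<gamma> \<otimes> u\<^sub>\<gamma>)(r) - \<alpha> r\<close> is invariant for all \<open>\<gamma>\<close>. In terms of operators,
  \<open>\<gamma>(\<alpha>) u\<^sub>\<gamma> S u\<^sub>\<gamma>\<^sup>-\<^sup>1 - \<alpha> S\<close> is a scalar, and it is skew, hence zero. As \<open>S\<close> and its conjugate satisfy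
  the same inhomogeneous quadratic equation and \<open>c \<noteq> 0\<close>, this forces \<open>\<gamma>(\<alpha>)\<^sup>2 = \<alpha>\<^sup>2\<close>; the two signs give
  \<open>(u\<^sub>\<gamma> \<otimes> u\<^sub>\<gamma>)(r) = r\<close> and \<open>(u\<^sub>\<gamma> \<otimes> u\<^sub>\<gamma>)(r) = \<kappa>(r)\<close>.
\<close>


text \<open>The statement that only scalars commute with all \<open>ad x\<close> is needed over the
  algebraic closure, while simplicity is given for the rational form only. What prevents a larger
  centroid from appearing after extension is splitness: it supplies eigenvalues in the base field.
  Splitness is used a second time, together with the order of the rationals, to see that the Killing
  form is nondegenerate without Cartan's criterion. Since K need not be ordered, both facts are
  settled over the rationals and extended afterwards. The other obstacle is that the descent takes
  place along an infinite Galois extension: it has to be shown that an element fixed by Gal(K) lies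
  in K, which uses separability in characteristic zero, and that a K-basis of the twisted fixed
  points stays independent over the closure. The Yang-Baxter equation enters twice, once to make
  \<alpha>\<delta> a Lie bialgebra structure over the closure and once to determine the square of
  \<gamma>(\<alpha>).\<close>

no_notation fps_nth (infixl "$" 75)

section \<open>Linear maps and tensors in coordinates\<close>

abbreviation lin :: "('a::field^'m::finite \<Rightarrow> 'a^'n::finite) \<Rightarrow> bool" where
  "lin f \<equiv> Vector_Spaces.linear (*s) (*s) f"

lemma lin_iff: "lin f \<longleftrightarrow> (\<forall>x y. f (x + y) = f x + f y) \<and> (\<forall>c x. f (c *s x) = c *s f x)"
  by (auto simp: Vector_Spaces.linear_iff vec.vector_space_axioms)

lemma linI: "(\<And>x y. f (x + y) = f x + f y) \<Longrightarrow> (\<And>c x. f (c *s x) = c *s f x) \<Longrightarrow> lin f"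
  by (simp add: lin_iff)

lemma lin_add: "lin f \<Longrightarrow> f (x + y) = f x + f y"
  and lin_scale: "lin f \<Longrightarrow> f (c *s x) = c *s f x"
  by (simp_all add: lin_iff)

lemma lin_zero: "lin f \<Longrightarrow> f 0 = 0"
  using lin_scale[of f 0 0] by simp

lemma lin_neg: "lin f \<Longrightarrow> f (- x) = - f x"
  using lin_scale[of f "-1" x] by (simp add: vec_eq_iff)

lemma lin_diff: "lin f \<Longrightarrow> f (x - y) = f x - f y"
  using lin_add[of f x "-y"] by (simp add: lin_neg)

lemma lin_sum: "lin f \<Longrightarrow> f (sum g A) = (\<Sum>i\<in>A. f (g i))"
  by (induction A rule: infinite_finite_induct) (simp_all add: lin_zero lin_add)

lemma lin_id [simp]: "lin id" "lin (\<lambda>x. x)"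
  by (simp_all add: lin_iff)

lemma lin_compose: "lin f \<Longrightarrow> lin g \<Longrightarrow> lin (\<lambda>x. f (g x))"
  by (simp add: lin_iff)

lemma axis_one_nth: "axis i 1 $ k = (if k = i then 1 else 0)"
  by (simp add: axis_def)

lemma axis_expansion: "x = (\<Sum>i\<in>UNIV. x $ i *s axis i (1::'a::field))"
  by (simp add: vec_eq_iff axis_def if_distrib cong: if_cong)

text \<open>The scalar stays in the base case, so that the rule also serves maps that are merely
  additive or semilinear, such as \<open>ext_vec\<close>.\<close>

lemma vec_induct [case_names axis add]:
  fixes x :: "'a::field^'n::finite"
  assumes ax: "\<And>c i. P (c *s axis i 1)" and add: "\<And>x y. P x \<Longrightarrow> P y \<Longrightarrow> P (x + y)"
  shows "P x"
proof -
  have P0: "P 0" using ax[of 0] by simp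
  have "P (\<Sum>i\<in>A. x $ i *s axis i 1)" for A
    by (induction A rule: infinite_finite_induct) (simp_all add: P0 ax add)
  then show ?thesis using axis_expansion[of x] by metis
qed

lemma lin_eqI:
  assumes "lin f" "lin g" "\<And>i. f (axis i 1) = g (axis i 1)"
  shows "f x = g x"
  by (induction x rule: vec_induct) (simp_all add: assms lin_add lin_scale)

section \<open>Tensors in coordinates\<close>

lemma tens_axis: "tens (axis i 1) (axis j 1) = axis (i, j) (1::'a::field)"
  by (auto simp: tens_def axis_def vec_eq_iff)

lemma tens_nth [simp]: "tens x y $ (i, j) = x $ i * y $ j"
  by (simp add: tens_def)

lemma tens_add_left: "tens (x + y) z = tens x z + tens y z"
  and tens_add_right: "tens z (x + y) = tens z x + tens z y"
  and tens_scale_left: "tens (c *s x) z = c *s tens x z"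
  and tens_scale_right: "tens z (c *s x) = c *s tens z x"
  by (simp_all add: tens_def vec_eq_iff algebra_simps)

lemma tens_diff_left: "tens (x - y) z = tens x z - tens y z"
  and tens_diff_right: "tens z (x - y) = tens z x - tens z y"
  by (simp_all add: tens_def vec_eq_iff algebra_simps)

lemmas tens_bilinear = tens_add_left tens_add_right tens_scale_left tens_scale_right

text \<open>Takes the place of the universal property: an additive identity between tensors need
  only be checked on pure ones, scalars being absorbed into the first factor.\<close>

lemma tens_induct [case_names tens add]:
  fixes t :: "'a::field^('m::finite \<times> 'n::finite)"
  assumes "\<And>x y. P (tens x y)" and "\<And>s t. P s \<Longrightarrow> P t \<Longrightarrow> P (s + t)"
  shows "P t"
proof (induction t rule: vec_induct)
  case (axis c p)
  obtain i j where p: "p = (i, j)" by force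
  have "c *s axis p 1 = tens (c *s axis i 1) (axis j (1::'a))"
    by (simp add: p tens_scale_left tens_axis)
  then show ?case using assms(1) by simp
qed (rule assms(2))

lemma tens3_induct [case_names tens add]:
  fixes t :: "'a::field^('l::finite \<times> 'm::finite \<times> 'n::finite)"
  assumes "\<And>x y z. P (tens x (tens y z))" and "\<And>s t. P s \<Longrightarrow> P t \<Longrightarrow> P (s + t)"
  shows "P t"
proof (induction t rule: tens_induct)
  case (tens x y)
  show ?case by (induction y rule: tens_induct) (simp_all add: assms tens_add_right)
qed (rule assms(2))

lemma tens_map_lin: "lin (tens_map f g)"
  unfolding tens_map_def
  by (rule linI) (simp_all add: split_def vector_sadd_rdistrib sum.distrib vec.scale_sum_right)

lemmas tens_map_add = lin_add[OF tens_map_lin]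
lemmas tens_map_scale = lin_scale[OF tens_map_lin]
lemmas tens_map_diff = lin_diff[OF tens_map_lin]
lemmas tens_map_zero = lin_zero[OF tens_map_lin]

lemma tens_map_axis: "tens_map f g (axis (i, j) 1) = tens (f (axis i 1)) (g (axis j 1))"
proof -
  have "tens_map f g (axis (i, j) 1)
      = (\<Sum>p\<in>UNIV. if p = (i, j) then tens (f (axis i 1)) (g (axis j 1)) else 0)"
    unfolding tens_map_def by (rule sum.cong) (auto simp: axis_one_nth split: if_splits)
  then show ?thesis by simp
qed

lemma tens_map_tens [simp]:
  assumes f: "lin f" and g: "lin g"
  shows "tens_map f g (tens x y) = tens (f x) (g y)"
proof (induction x rule: vec_induct)
  case (axis c i)
  have "tens_map f g (tens (axis i 1) y) = tens (f (axis i 1)) (g y)"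
    by (induction y rule: vec_induct)
      (simp_all add: tens_add_right tens_scale_right tens_axis tens_map_add tens_map_scale
        tens_map_axis lin_scale[OF g] lin_add[OF g])
  then show ?case
    by (simp add: tens_scale_left tens_map_scale lin_scale[OF f])
qed (simp_all add: tens_add_left tens_map_add lin_add[OF f])

lemma tens_map_compose:
  assumes "lin f" "lin g" "lin f'" "lin g'"
  shows "tens_map f g (tens_map f' g' t) = tens_map (\<lambda>x. f (f' x)) (\<lambda>x. g (g' x)) t"
  by (induction t rule: tens_induct) (simp_all add: assms lin_compose tens_map_add)

lemma tens_map_ident [simp]: "tens_map (\<lambda>x. x) (\<lambda>x. x) t = t"
  by (induction t rule: tens_induct) (simp_all add: tens_map_add)

lemma flip_tens [simp]: "flip (tens x y) = tens y x"
  by (simp add: flip_def tens_def vec_eq_iff mult.commute)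

lemma flip_lin: "lin flip"
  by (rule linI) (simp_all add: flip_def vec_eq_iff)

lemmas flip_add = lin_add[OF flip_lin]
lemmas flip_scale = lin_scale[OF flip_lin]

lemma flip_tens_map: "lin f \<Longrightarrow> lin g \<Longrightarrow> flip (tens_map f g t) = tens_map g f (flip t)"
  by (induction t rule: tens_induct) (simp_all add: tens_map_add flip_add)

lemma cyc_tens [simp]: "cyc (tens x (tens y z)) = tens y (tens z x)"
  by (auto simp: cyc_def tens_def vec_eq_iff ac_simps split: prod.splits)

lemma cyc_lin: "lin cyc"
  by (rule linI) (auto simp: cyc_def vec_eq_iff split: prod.splits)

lemmas cyc_add = lin_add[OF cyc_lin]

lemma cyc_tens_map:
  "lin f \<Longrightarrow> cyc (tens_map f (tens_map f f) t) = tens_map f (tens_map f f) (cyc t)"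
  by (induction t rule: tens3_induct) (simp_all add: tens_map_add cyc_add tens_map_lin)

section \<open>Field homomorphisms and scalar extension\<close>

definition field_hom :: "('a::field \<Rightarrow> 'b::field) \<Rightarrow> bool" where
  "field_hom h \<longleftrightarrow> h 1 = 1 \<and> (\<forall>x y. h (x + y) = h x + h y) \<and> (\<forall>x y. h (x * y) = h x * h y)"

context
  fixes h :: "'a::field \<Rightarrow> 'b::field"
  assumes h: "field_hom h"
begin

lemma field_hom_one: "h 1 = 1"
  and field_hom_add: "h (x + y) = h x + h y"
  and field_hom_mult: "h (x * y) = h x * h y"
  using h by (auto simp: field_hom_def)

lemma field_hom_zero: "h 0 = 0"
  using field_hom_add[of 0 0] by (metis add_cancel_right_right)

lemma field_hom_neg: "h (- x) = - h x"
  using field_hom_add[of x "-x"] by (simp add: field_hom_zero eq_neg_iff_add_eq_0 add.commute)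

lemma field_hom_diff: "h (x - y) = h x - h y"
  using field_hom_add[of x "-y"] by (simp add: field_hom_neg)

lemma field_hom_sum: "h (sum f A) = (\<Sum>i\<in>A. h (f i))"
  by (induction A rule: infinite_finite_induct) (simp_all add: field_hom_zero field_hom_add)

lemma field_hom_eq_zero: "h x = 0 \<longleftrightarrow> x = 0"
proof
  assume "h x = 0"
  then show "x = 0"
    using field_hom_mult[of x "inverse x"] field_hom_one by (cases "x = 0") auto
qed (simp add: field_hom_zero)

lemma field_hom_eq: "h x = h y \<longleftrightarrow> x = y"
  using field_hom_eq_zero[of "x - y"] by (simp add: field_hom_diff)

lemma field_hom_inverse: "h (inverse x) = inverse (h x)"
  using field_hom_mult[of x "inverse x"] field_hom_one
  by (cases "x = 0") (auto simp: field_hom_zero inverse_unique)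

lemma field_hom_power: "h (x ^ n) = h x ^ n"
  by (induction n) (auto simp: field_hom_one field_hom_mult)

lemma ext_vec_nth: "ext_vec h x $ i = h (x $ i)"
  by (simp add: ext_vec_def)

lemma ext_vec_add: "ext_vec h (x + y) = ext_vec h x + ext_vec h y"
  and ext_vec_scale: "ext_vec h (c *s x) = h c *s ext_vec h x"
  and ext_vec_zero: "ext_vec h 0 = 0"
  and ext_vec_neg: "ext_vec h (- x) = - ext_vec h x"
  and ext_vec_diff: "ext_vec h (x - y) = ext_vec h x - ext_vec h y"
  and ext_vec_axis: "ext_vec h (axis i 1) = axis i 1"
  by (simp_all add: ext_vec_def vec_eq_iff axis_def field_hom_add field_hom_mult field_hom_zero
      field_hom_neg field_hom_diff field_hom_one)

lemma ext_vec_sum: "ext_vec h (sum f A) = (\<Sum>i\<in>A. ext_vec h (f i))"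
  by (induction A rule: infinite_finite_induct) (simp_all add: ext_vec_zero ext_vec_add)

lemma ext_vec_eq: "ext_vec h x = ext_vec h y \<longleftrightarrow> x = y"
  by (simp add: ext_vec_def vec_eq_iff field_hom_eq)

lemma ext_vec_eq_zero: "ext_vec h x = 0 \<longleftrightarrow> x = 0"
  using ext_vec_eq[of x 0] by (simp add: ext_vec_zero)

lemma ext_vec_tens: "ext_vec h (tens x y) = tens (ext_vec h x) (ext_vec h y)"
  by (simp add: ext_vec_def tens_def vec_eq_iff field_hom_mult)

lemma ext_vec_flip: "ext_vec h (flip t) = flip (ext_vec h t)"
  by (simp add: ext_vec_def flip_def vec_eq_iff)

lemma ext_vec_cyc: "ext_vec h (cyc t) = cyc (ext_vec h t)"
  by (auto simp: ext_vec_def cyc_def vec_eq_iff split: prod.splits)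

section \<open>Linear extension along a field homomorphism\<close>

lemma lin_lift_lin: "lin (lin_lift f)"
  unfolding lin_lift_def
  by (rule linI) (simp_all add: vector_sadd_rdistrib sum.distrib vec.scale_sum_right)

lemma lin_lift_axis: "lin_lift f (axis i 1) = f (axis i 1)"
proof -
  have "lin_lift f (axis i 1) = (\<Sum>k\<in>UNIV. if k = i then f (axis i 1) else 0)"
    unfolding lin_lift_def by (rule sum.cong) (auto simp: axis_def)
  then show ?thesis by simp
qed

lemma lin_lift_ext_vec:
  fixes f :: "'a^'m::finite \<Rightarrow> 'b^'n::finite"
  assumes "\<And>x y. f (x + y) = f x + f y" "\<And>c x. f (c *s x) = h c *s f x"
  shows "lin_lift f (ext_vec h x) = f x"
proof (induction x rule: vec_induct)
  case (axis c i)
  show ?case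
    by (simp add: ext_vec_scale lin_scale[OF lin_lift_lin] assms ext_vec_axis lin_lift_axis)
qed (simp add: ext_vec_add lin_add[OF lin_lift_lin] assms)

lemma ext_lin_lin: "lin (ext_lin h f)"
  unfolding ext_lin_def by (rule lin_lift_lin)

lemma ext_lin_axis: "ext_lin h f (axis i 1) = ext_vec h (f (axis i 1))"
  by (simp add: ext_lin_def lin_lift_axis)

lemma ext_lin_ext_vec: "lin f \<Longrightarrow> ext_lin h f (ext_vec h x) = ext_vec h (f x)"
  unfolding ext_lin_def
  by (subst lin_lift_ext_vec) (simp_all add: lin_add lin_scale ext_vec_add ext_vec_scale)

lemma ext_vec_tens_map:
  assumes "lin f" "lin g"
  shows "ext_vec h (tens_map f g t) = tens_map (ext_lin h f) (ext_lin h g) (ext_vec h t)"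
  by (induction t rule: tens_induct)
    (simp_all add: assms ext_lin_lin ext_lin_ext_vec tens_map_add ext_vec_add ext_vec_tens)

lemma ext_lin_id: "ext_lin h id = id"
proof
  show "ext_lin h id x = id x" for x
    by (rule lin_eqI[OF ext_lin_lin]) (simp_all add: ext_lin_axis ext_vec_axis)
qed

lemma ext_bracket_lin: "lin (ext_bracket h B x)" "lin (\<lambda>x. ext_bracket h B x y)"
  unfolding ext_bracket_def
  by (rule linI; simp add: vector_sadd_rdistrib sum.distrib vec.scale_sum_right algebra_simps)+

lemma ext_bracket_axis:
  "ext_bracket h B (axis i 1) (axis j 1) = ext_vec h (B (axis i 1) (axis j 1))"
proof -
  have "(axis i 1 $ k * axis j 1 $ l) *s ext_vec h (B (axis k 1) (axis l 1))
      = (if k = i then if l = j then ext_vec h (B (axis i 1) (axis j 1)) else 0 else 0)" for k l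
    by (simp add: axis_one_nth)
  then show ?thesis by (simp add: ext_bracket_def sum.If_cases)
qed

lemma ext_bracket_ext_vec:
  assumes B: "\<And>x. lin (B x)" "\<And>y. lin (\<lambda>x. B x y)"
  shows "ext_bracket h B (ext_vec h x) (ext_vec h y) = ext_vec h (B x y)"
proof (induction x rule: vec_induct)
  case (axis c i)
  show ?case
  proof (induction y rule: vec_induct)
    case (axis d j)
    show ?case
      by (simp add: ext_vec_scale ext_vec_axis lin_scale[OF ext_bracket_lin(1)] ext_bracket_axis
          lin_scale[OF ext_bracket_lin(2)] lin_scale[OF B(1)] lin_scale[OF B(2)]
          field_hom_mult mult.commute)
  qed (simp add: ext_vec_add lin_add[OF ext_bracket_lin(1)] lin_add[OF B(1)])
qed (simp add: ext_vec_add lin_add[OF ext_bracket_lin(2)] lin_add[OF B(2)])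

end

section \<open>The Killing form\<close>

lemma matrix_diff_rdistrib: "(A' - B') ** C' = A' ** C' - B' ** (C' :: 'b::ring_1^'n^'m)"
  and matrix_diff_ldistrib: "C' ** (A'' - B'') = C' ** A'' - C' ** (B'' :: 'b^'k^'n)"
  by (vector matrix_matrix_mult_def sum.distrib sum_subtractf algebra_simps)+

context
  fixes B :: "('a::field, 'n::finite) bracket"
  assumes B: "lie_algebra B"
begin

lemma lie_lin: "lin (B x)" "lin (\<lambda>x. B x y)"
  using B by (auto simp: lie_algebra_def)

lemmas lie_add_right = lin_add[OF lie_lin(1)]
  and lie_add_left = lin_add[OF lie_lin(2)]
  and lie_scale_right = lin_scale[OF lie_lin(1)]
  and lie_scale_left = lin_scale[OF lie_lin(2)]
  and lie_diff_right = lin_diff[OF lie_lin(1)]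
  and lie_diff_left = lin_diff[OF lie_lin(2)]
  and lie_neg_right = lin_neg[OF lie_lin(1)]
  and lie_zero_right = lin_zero[OF lie_lin(1)]
  and lie_zero_left = lin_zero[OF lie_lin(2)]
  and lie_sum_right = lin_sum[OF lie_lin(1)]
  and lie_sum_left = lin_sum[OF lie_lin(2)]

lemma lie_self: "B x x = 0"
  using B by (auto simp: lie_algebra_def)

lemma lie_skew: "B x y = - B y x"
proof -
  have "B (x + y) (x + y) = B x x + B x y + (B y x + B y y)"
    by (simp only: lie_add_left lie_add_right ac_simps)
  then have "B x y + B y x = 0"
    by (simp add: lie_self)
  then show ?thesis
    by (simp only: eq_neg_iff_add_eq_0)
qed

lemma lie_jacobi: "B x (B y z) + B y (B z x) + B z (B x y) = 0"
  using B by (auto simp: lie_algebra_def)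

lemma lie_jacobi': "B (B x y) z = B x (B y z) - B y (B x z)"
proof -
  have "B (B x y) z = - B z (B x y)"
    by (rule lie_skew)
  also have "\<dots> = B x (B y z) + B y (B z x)"
    using minus_unique[OF lie_jacobi[of x y z], symmetric] by simp
  also have "B y (B z x) = - B y (B x z)"
    using lie_skew[of z x] by (simp add: lie_neg_right)
  finally show ?thesis by simp
qed

lemma killing_form_alt: "killing_form B x y = trace (matrix (B x) ** matrix (B y))"
  unfolding killing_form_def by (simp only: matrix_compose_gen[OF lie_lin(1) lie_lin(1)])

lemma killing_form_sym: "killing_form B x y = killing_form B y x"
  unfolding killing_form_alt by (rule trace_mul_sym)

lemma killing_form_expand:
  "killing_form B x y = (\<Sum>i\<in>UNIV. \<Sum>k\<in>UNIV. B x (axis k 1) $ i * B y (axis i 1) $ k)"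
  by (simp add: killing_form_alt trace_def matrix_matrix_mult_def matrix_def)

lemma killing_form_add_left: "killing_form B (x + y) z = killing_form B x z + killing_form B y z"
  by (simp add: killing_form_expand lie_add_left distrib_right sum.distrib)

lemma killing_form_scale_left: "killing_form B (c *s x) z = c * killing_form B x z"
  by (simp add: killing_form_expand lie_scale_left sum_distrib_left mult.assoc)

lemma killing_form_add_right: "killing_form B z (x + y) = killing_form B z x + killing_form B z y"
  by (simp add: killing_form_sym[of z] killing_form_add_left)

lemma killing_form_scale_right: "killing_form B z (c *s x) = c * killing_form B z x"
  by (simp add: killing_form_sym[of z] killing_form_scale_left)

lemma killing_form_zero_left: "killing_form B 0 y = 0"
  using killing_form_scale_left[of 0 0 y] by simp

lemma killing_form_zero_right: "killing_form B y 0 = 0"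
  using killing_form_scale_right[of y 0 0] by simp

lemma killing_form_neg_left: "killing_form B (- x) y = - killing_form B x y"
  using killing_form_scale_left[of "-1" x y] by simp

lemma killing_form_neg_right: "killing_form B x (- y) = - killing_form B x y"
  using killing_form_scale_right[of x "-1" y] by simp

lemma killing_form_diff_left: "killing_form B (x - y) z = killing_form B x z - killing_form B y z"
  using killing_form_add_left[of x "-y" z] by (simp add: killing_form_neg_left)

lemma killing_form_diff_right: "killing_form B z (x - y) = killing_form B z x - killing_form B z y"
  using killing_form_add_right[of z x "-y"] by (simp add: killing_form_neg_right)

lemma killing_form_sum_left: "killing_form B (sum f A) y = (\<Sum>i\<in>A. killing_form B (f i) y)"
  by (induction A rule: infinite_finite_induct)
    (simp_all add: killing_form_zero_left killing_form_add_left)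

lemma killing_form_sum_right: "killing_form B y (sum f A) = (\<Sum>i\<in>A. killing_form B y (f i))"
  by (induction A rule: infinite_finite_induct)
    (simp_all add: killing_form_zero_right killing_form_add_right)

text \<open>As \<open>ad\<close> turns brackets into commutators, the two sides differ only by a
  cyclic permutation under the trace.\<close>

lemma killing_form_invariant: "killing_form B (B x y) z = killing_form B x (B y z)"
proof -
  have *: "matrix (B (B x y)) = matrix (B x) ** matrix (B y) - matrix (B y) ** matrix (B x)" for x y
  proof -
    have "matrix (B x) ** matrix (B y) = matrix (B x \<circ> B y)" for x y
      by (simp add: matrix_compose_gen lie_lin)
    then show ?thesis
      by (simp add: matrix_def vec_eq_iff lie_jacobi')
  qed
  let ?m = "\<lambda>x. matrix (B x)"
  have "killing_form B (B x y) z = trace (?m x ** ?m y ** ?m z) - trace (?m y ** ?m x ** ?m z)"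
    by (simp add: killing_form_alt * trace_sub matrix_diff_rdistrib)
  also have "trace (?m y ** ?m x ** ?m z) = trace (?m x ** ?m z ** ?m y)"
    using trace_mul_sym[of "?m y" "?m x ** ?m z"] by (simp add: matrix_mul_assoc)
  finally show ?thesis
    by (simp add: killing_form_alt * trace_sub matrix_diff_ldistrib matrix_mul_assoc)
qed

text \<open>\<open>ad\<close> of \<phi>(x) is the conjugate of \<open>ad x\<close> by \<phi>, and
  traces do not see conjugation.\<close>

lemma killing_form_aut:
  assumes \<phi>: "\<phi> \<in> lie_aut B"
  shows "killing_form B (\<phi> x) (\<phi> y) = killing_form B x y"
proof -
  have lin: "lin \<phi>" and bij: "bij \<phi>" and hom: "\<And>x y. \<phi> (B x y) = B (\<phi> x) (\<phi> y)"
    using \<phi> by (auto simp: lie_aut_def lie_iso_def)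
  obtain \<psi> where \<psi>: "lin \<psi>" "\<psi> \<circ> \<phi> = id"
    using vec.linear_injective_left_inverse[OF lin] bij by (auto simp: bij_def)
  have "\<phi> (\<psi> x) = x" for x
    using \<psi>(2) bij by (metis bij_pointE comp_apply id_apply)
  then have *: "B (\<phi> x) = \<phi> \<circ> (B x \<circ> \<psi>)" for x
    by (auto simp: hom)
  have "matrix \<psi> ** matrix \<phi> = mat 1"
    using matrix_compose_gen[OF lin \<psi>(1)] by (simp only: \<psi>(2) matrix_id_mat_1)
  have "matrix (B (\<phi> x)) = matrix \<phi> ** (matrix (B x) ** matrix \<psi>)" for x
  proof -
    have "lin (B x \<circ> \<psi>)"
      using lin_compose[OF lie_lin(1) \<psi>(1)] by (simp add: comp_def)
    then show ?thesis
      unfolding * using \<psi> lin by (simp add: matrix_compose_gen lie_lin)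
  qed
  then have "matrix (B (\<phi> x)) ** matrix (B (\<phi> y))
      = matrix \<phi> ** (matrix (B x) ** (matrix \<psi> ** matrix \<phi>) ** matrix (B y) ** matrix \<psi>)"
    by (simp only: matrix_mul_assoc)
  then have "matrix (B (\<phi> x)) ** matrix (B (\<phi> y))
      = matrix \<phi> ** (matrix (B x) ** matrix (B y) ** matrix \<psi>)"
    by (simp only: \<open>matrix \<psi> ** matrix \<phi> = mat 1\<close> matrix_mul_rid)
  then have "killing_form B (\<phi> x) (\<phi> y)
      = trace (matrix (B x) ** matrix (B y) ** matrix \<psi> ** matrix \<phi>)"
    by (simp only: killing_form_alt trace_mul_sym[of "matrix \<phi>"])
  then show ?thesis
    using \<open>matrix \<psi> ** matrix \<phi> = mat 1\<close>
    by (simp add: killing_form_alt matrix_mul_assoc [symmetric])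
qed

section \<open>The action on the tensor square\<close>

lemma ad2_lin: "lin (ad2 B x)"
  by (rule linI) (simp_all add: ad2_def tens_map_add tens_map_scale vec.scale_right_distrib)

lemmas ad2_add = lin_add[OF ad2_lin]
  and ad2_scale = lin_scale[OF ad2_lin]
  and ad2_diff = lin_diff[OF ad2_lin]

lemma ad2_tens: "ad2 B x (tens a b) = tens (B x a) b + tens a (B x b)"
  by (simp add: ad2_def lie_lin)

lemma ad2_lin_left: "lin (\<lambda>x. ad2 B x t)"
proof (induction t rule: tens_induct)
  case (tens a b)
  show ?case
    by (rule linI) (simp_all add: ad2_tens lie_add_left lie_scale_left tens_bilinear
        vec.scale_right_distrib)
next
  case (add s t)
  then show ?case
    by (simp add: ad2_add lin_iff vec.scale_right_distrib)
qed

lemma ad2_flip: "flip (ad2 B x t) = ad2 B x (flip t)"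
  by (induction t rule: tens_induct) (simp_all add: ad2_tens ad2_add flip_add)

lemma ad2_bracket: "ad2 B (B x y) t = ad2 B x (ad2 B y t) - ad2 B y (ad2 B x t)"
  by (induction t rule: tens_induct)
    (simp_all add: ad2_tens ad2_add lie_jacobi' tens_diff_left tens_diff_right)

text \<open>Makes \<open>\<alpha> *s r\<close> an r-matrix again, so that \<alpha>\<delta> is a Lie
  bialgebra structure over the closure.\<close>

lemma CYB_scale: "CYB B (\<alpha> *s r) = \<alpha>\<^sup>2 *s CYB B r"
  unfolding CYB_def split_def Let_def vec.scale_sum_right
proof (intro sum.cong refl, goal_cases)
  case (1 p q)
  show ?case
    by (simp add: lie_scale_left lie_scale_right tens_bilinear vec.scale_right_distrib
        power2_eq_square vector_smult_assoc mult.commute mult.assoc mult.left_commute)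
qed

end

section \<open>Lie algebras with a Casimir element and trivial centroid\<close>

text \<open>The properties of \<gg> that the operator argument uses, separated from the way in which
  \<gg> arises from a rational form. \<open>casimir\<close> says that \<Omega> inverts the Gram
  matrix of the Killing form and thereby contains its nondegeneracy.\<close>

locale casimir_lie_algebra =
  fixes B :: "('a::field_char_0, 'n::finite) bracket" and \<Omega> :: "'a^('n \<times> 'n)"
  assumes lie: "lie_algebra B"
    and casimir: "(\<Sum>k\<in>UNIV. \<Omega> $ (i, k) * killing_form B (axis k 1) b) = b $ i"
    and centroid: "lin T \<Longrightarrow> (\<And>x y. T (B x y) = B x (T y)) \<Longrightarrow> \<exists>\<mu>. \<forall>x. T x = \<mu> *s x"
    and nonabelian: "\<exists>x y. B x y \<noteq> 0"
begin

abbreviation \<kappa> where "\<kappa> \<equiv> killing_form B"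

lemmas kappa_add_left = killing_form_add_left[OF lie]
  and kappa_add_right = killing_form_add_right[OF lie]
  and kappa_scale_left = killing_form_scale_left[OF lie]
  and kappa_scale_right = killing_form_scale_right[OF lie]
  and kappa_diff_left = killing_form_diff_left[OF lie]
  and kappa_diff_right = killing_form_diff_right[OF lie]
  and kappa_neg_left = killing_form_neg_left[OF lie]
  and kappa_neg_right = killing_form_neg_right[OF lie]
  and kappa_sum_left = killing_form_sum_left[OF lie]
  and kappa_sum_right = killing_form_sum_right[OF lie]
  and kappa_sym = killing_form_sym[OF lie]
  and kappa_invariant = killing_form_invariant[OF lie]

lemmas B_add_left = lie_add_left[OF lie]
  and B_add_right = lie_add_right[OF lie]
  and B_scale_left = lie_scale_left[OF lie]
  and B_scale_right = lie_scale_right[OF lie]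
  and B_diff_left = lie_diff_left[OF lie]
  and B_diff_right = lie_diff_right[OF lie]
  and B_sum_left = lie_sum_left[OF lie]
  and B_sum_right = lie_sum_right[OF lie]
  and B_skew = lie_skew[OF lie]

text \<open>The second factor has an index type of its own so that tensors of degree three can be
  contracted as well.\<close>

definition contr :: "('a^'k::finite \<Rightarrow> 'a) \<Rightarrow> 'a^('n \<times> 'k) \<Rightarrow> 'a^'n" where
  "contr f t = (\<chi> i. \<Sum>k\<in>UNIV. t $ (i, k) * f (axis k 1))"

text \<open>The operator \<open>a \<otimes> b \<mapsto> (x \<mapsto> \<kappa>(b, x) a)\<close>, which turns the Casimir element into the identity.\<close>

definition tensor_op :: "'a^('n \<times> 'n) \<Rightarrow> 'a^'n \<Rightarrow> 'a^'n" where
  "tensor_op t x = contr (\<lambda>b. \<kappa> b x) t"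

text \<open>The basis dual to the standard one under the Killing form; pairing with it reads off
  coordinates, which recovers a tensor from its operator.\<close>

definition dual :: "'n \<Rightarrow> 'a^'n" where
  "dual i = (\<chi> k. \<Omega> $ (i, k))"

lemma kappa_expand: "\<kappa> x y = (\<Sum>k\<in>UNIV. x $ k * \<kappa> (axis k 1) y)"
proof -
  have "\<kappa> x y = \<kappa> (\<Sum>k\<in>UNIV. x $ k *s axis k 1) y"
    by (simp only: axis_expansion[symmetric])
  then show ?thesis
    by (simp only: kappa_sum_left kappa_scale_left)
qed

lemma kappa_dual: "\<kappa> (dual i) x = x $ i"
  using casimir[of i x] kappa_expand[of "dual i" x] by (simp add: dual_def)

lemma kappa_nondegenerate:
  assumes "\<And>y. \<kappa> y x = \<kappa> y x'"
  shows "x = x'"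
  using assms[of "dual _"] by (simp add: kappa_dual vec_eq_iff)

lemma contr_lin: "lin (contr f)"
  by (rule linI) (simp_all add: contr_def vec_eq_iff distrib_right sum.distrib sum_distrib_left
      mult.assoc)

lemma contr_tens:
  assumes "\<And>x y. f (x + y) = f x + f y" "\<And>c x. f (c *s x) = c * f x"
  shows "contr f (tens a b) = f b *s a"
proof -
  have f0: "f 0 = 0" using assms(2)[of 0 0] by simp
  have "f (sum g A) = (\<Sum>k\<in>A. f (g k))" for g and A :: "'b set"
    by (induction A rule: infinite_finite_induct) (simp_all add: f0 assms)
  then have "f b = (\<Sum>k\<in>UNIV. b $ k * f (axis k 1))"
    using axis_expansion[of b] assms(2) by (smt (verit) sum.cong)
  then show ?thesis
    by (simp add: contr_def vec_eq_iff sum_distrib_left sum_distrib_right ac_simps)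
qed

lemma tensor_op_lin_left: "lin (\<lambda>t. tensor_op t x)"
  unfolding tensor_op_def by (rule contr_lin)

lemmas tensor_op_add_left = lin_add[OF tensor_op_lin_left]
  and tensor_op_scale_left = lin_scale[OF tensor_op_lin_left]
  and tensor_op_diff_left = lin_diff[OF tensor_op_lin_left]
  and tensor_op_zero_left = lin_zero[OF tensor_op_lin_left]
  and tensor_op_sum_left = lin_sum[OF tensor_op_lin_left]

lemma tensor_op_lin: "lin (tensor_op t)"
  by (rule linI)
    (simp_all add: tensor_op_def contr_def vec_eq_iff kappa_add_right kappa_scale_right distrib_left
      sum.distrib sum_distrib_left mult.left_commute)

lemmas tensor_op_add = lin_add[OF tensor_op_lin]
  and tensor_op_scale = lin_scale[OF tensor_op_lin]

lemma tensor_op_tens: "tensor_op (tens a b) x = \<kappa> b x *s a"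
  unfolding tensor_op_def by (rule contr_tens) (simp_all add: kappa_add_left kappa_scale_left)

lemma tensor_op_casimir: "tensor_op \<Omega> x = x"
  by (simp add: tensor_op_def contr_def vec_eq_iff casimir)

lemma kappa_op_flip: "\<kappa> (tensor_op (flip t) x) y = \<kappa> x (tensor_op t y)"
  by (induction t rule: tens_induct)
    (simp_all add: tensor_op_tens tensor_op_add_left flip_add kappa_add_left kappa_add_right kappa_scale_left
      kappa_scale_right kappa_sym mult.commute)

lemma tensor_op_dual: "\<kappa> (dual i) (tensor_op t (dual k)) = t $ (i, k)"
proof (induction t rule: tens_induct)
  case (tens a b)
  show ?case
    using kappa_sym[of b "dual k"] by (simp add: tensor_op_tens kappa_scale_right kappa_dual)
qed (simp add: tensor_op_add_left kappa_add_right)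

lemma tensor_op_eqI:
  assumes "\<And>x. tensor_op s x = tensor_op t x"
  shows "s = t"
proof -
  have "s $ (i, k) = t $ (i, k)" for i k
    unfolding tensor_op_dual[symmetric] by (simp add: assms)
  then show ?thesis by (simp add: vec_eq_iff)
qed

text \<open>\<open>ad x\<close> is skew for the Killing form, so its action on the second factor
  becomes precomposition with a minus sign, and altogether a commutator with \<open>ad x\<close>
  appears.\<close>

lemma tensor_op_ad2: "tensor_op (ad2 B x t) y = B x (tensor_op t y) - tensor_op t (B x y)"
proof (induction t rule: tens_induct)
  case (tens a b)
  have "\<kappa> (B x b) y = - \<kappa> b (B x y)"
    using B_skew[of x b] by (simp add: kappa_neg_left kappa_invariant)
  then show ?case
    by (simp add: ad2_tens[OF lie] tensor_op_tens tensor_op_add_left B_scale_right)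
qed (simp add: ad2_add[OF lie] tensor_op_add_left B_add_right)

lemma ad2_casimir: "ad2 B x \<Omega> = 0"
  by (rule tensor_op_eqI) (simp add: tensor_op_ad2 tensor_op_casimir tensor_op_zero_left)

lemma tensor_op_tens_map_aut:
  assumes "\<phi> \<in> lie_aut B"
  shows "tensor_op (tens_map \<phi> \<phi> t) (\<phi> x) = \<phi> (tensor_op t x)"
proof -
  have lin: "lin \<phi>" using assms by (simp add: lie_aut_def lie_iso_def)
  show ?thesis
    by (induction t rule: tens_induct)
      (simp_all add: lin tensor_op_tens tens_map_add tensor_op_add_left lin_add[OF lin] lin_scale[OF lin]
        killing_form_aut[OF lie assms])
qed


text \<open>Pairing the second factor of CYB(r) with y and the third with z turns each of its three
  summands into one of the terms here, once invariance has moved the brackets across the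
  form.\<close>

lemma CYB_op:
  assumes "CYB B r = 0"
  shows "B (tensor_op r y) (tensor_op r z) = tensor_op r (B y (tensor_op r z)) - tensor_op r (B (tensor_op (flip r) y) z)"
proof -
  define s where "s p = r $ p *s axis (fst p) (1::'a)" for p :: "'n \<times> 'n"
  define t where "t p = axis (snd p) (1::'a)" for p :: "'n \<times> 'n"
  have r: "r = (\<Sum>p\<in>UNIV. tens (s p) (t p))"
    by (subst axis_expansion) (simp add: s_def t_def tens_scale_left tens_axis)
  have tensor_op_r: "tensor_op r x = (\<Sum>p\<in>UNIV. \<kappa> (t p) x *s s p)" for x
    by (subst r) (simp only: tensor_op_sum_left tensor_op_tens)
  have tensor_op_flip: "tensor_op (flip r) x = (\<Sum>p\<in>UNIV. \<kappa> (s p) x *s t p)" for x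
    by (subst r) (simp only: lin_sum[OF flip_lin] flip_tens tensor_op_sum_left tensor_op_tens)
  define e where "e = contr (\<lambda>w. \<kappa> y (tensor_op w z))"
  have e_lin: "lin e" unfolding e_def by (rule contr_lin)
  have e: "e (tens a (tens b c)) = (\<kappa> c z * \<kappa> y b) *s a" for a b c
    unfolding e_def
    by (subst contr_tens) (simp_all add: tensor_op_add_left tensor_op_scale_left kappa_add_right kappa_scale_right tensor_op_tens)
  have "e (CYB B r) = (\<Sum>p\<in>UNIV. \<Sum>q\<in>UNIV. (\<kappa> (t q) z * \<kappa> y (t p)) *s B (s p) (s q)
      + (\<kappa> (t q) z * \<kappa> y (B (t p) (s q))) *s s p + (\<kappa> (B (t p) (t q)) z * \<kappa> y (s q)) *s s p)"
    unfolding CYB_def split_def Let_def prod.collapse s_def[symmetric] t_def[symmetric]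
    by (simp only: lin_sum[OF e_lin] lin_add[OF e_lin] e)
  also have "\<dots> = (\<Sum>p\<in>UNIV. \<Sum>q\<in>UNIV. (\<kappa> (t q) z * \<kappa> y (t p)) *s B (s p) (s q))
      + (\<Sum>p\<in>UNIV. \<Sum>q\<in>UNIV. (\<kappa> (t q) z * \<kappa> y (B (t p) (s q))) *s s p)
      + (\<Sum>p\<in>UNIV. \<Sum>q\<in>UNIV. (\<kappa> (B (t p) (t q)) z * \<kappa> y (s q)) *s s p)"
    by (simp only: sum.distrib)
  also have "(\<Sum>p\<in>UNIV. \<Sum>q\<in>UNIV. (\<kappa> (t q) z * \<kappa> y (t p)) *s B (s p) (s q))
      = B (tensor_op r y) (tensor_op r z)"
    unfolding tensor_op_r B_sum_left B_sum_right B_scale_left B_scale_right vec.scale_sum_right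
    by (subst sum.swap, intro sum.cong refl) (simp add: kappa_sym[of y] ac_simps)
  also have "(\<Sum>p\<in>UNIV. \<Sum>q\<in>UNIV. (\<kappa> (t q) z * \<kappa> y (B (t p) (s q))) *s s p)
      = - tensor_op r (B y (tensor_op r z))"
  proof -
    have "\<kappa> y (B (t p) (s q)) = - \<kappa> (t p) (B y (s q))" for p q
      using B_skew[of y "t p"] by (simp add: kappa_invariant[symmetric] kappa_neg_left) 
    then show ?thesis
      unfolding tensor_op_r[of "B y (tensor_op r z)"] unfolding tensor_op_r[of z] B_sum_right B_scale_right
        kappa_sum_right kappa_scale_right vec.scale_sum_left sum_negf[symmetric]
      by (intro sum.cong refl) simp
  qed
  also have "(\<Sum>p\<in>UNIV. \<Sum>q\<in>UNIV. (\<kappa> (B (t p) (t q)) z * \<kappa> y (s q)) *s s p)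
      = tensor_op r (B (tensor_op (flip r) y) z)"
    unfolding tensor_op_flip tensor_op_r B_sum_left B_scale_left kappa_sum_right kappa_scale_right
      vec.scale_sum_left
    by (intro sum.cong refl) (simp add: kappa_invariant kappa_sym[of y] ac_simps)
  finally show ?thesis
    using assms lin_zero[OF e_lin] by (simp add: algebra_simps)
qed

section \<open>The skew part of an r-matrix and the dual bracket\<close>

definition skew_op :: "'a \<Rightarrow> 'a^('n \<times> 'n) \<Rightarrow> 'a^'n \<Rightarrow> 'a^'n" where
  "skew_op c r x = tensor_op r x - (c / 2) *s x"

lemma skew_op_lin: "lin (skew_op c r)"
  by (rule linI) (simp_all add: skew_op_def tensor_op_add tensor_op_scale vec.scale_right_distrib
      vec.scale_right_diff_distrib mult.commute)

context
  fixes r c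
  assumes sym: "r + flip r = c *s \<Omega>"
begin

lemma tensor_op_flip_eq: "tensor_op (flip r) x = c *s x - tensor_op r x"
proof -
  have "flip r = c *s \<Omega> - r" using sym by (simp add: algebra_simps)
  then show ?thesis by (simp add: tensor_op_diff_left tensor_op_scale_left tensor_op_casimir)
qed

lemma ad2_flip_eq: "ad2 B x (flip r) = - ad2 B x r"
proof -
  have "flip r = c *s \<Omega> - r" using sym by (simp add: algebra_simps)
  then show ?thesis
    by (simp add: ad2_diff[OF lie] ad2_scale[OF lie] ad2_casimir)
qed

lemma kappa_skew_op: "\<kappa> (skew_op c r x) y = - \<kappa> x (skew_op c r y)"
proof -
  have "\<kappa> (tensor_op r x) y = c * \<kappa> x y - \<kappa> (tensor_op (flip r) x) y"
    by (simp add: tensor_op_flip_eq kappa_diff_left kappa_scale_left)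
  then show ?thesis
    by (simp add: skew_op_def kappa_op_flip kappa_diff_left kappa_diff_right kappa_scale_left
        kappa_scale_right)
qed

lemma tensor_op_ad2_skew_op: "tensor_op (ad2 B x r) y = B x (skew_op c r y) - skew_op c r (B x y)"
  by (simp add: tensor_op_ad2 skew_op_def B_diff_right B_scale_right)

text \<open>Up to sign, the bracket on the dual space that is given by the coboundary of
  \<open>r\<close>, carried over to \<gg> by the Killing form; see
  \<open>kappa_coboundary\<close>.\<close>

definition dual_bracket :: "'a^'n \<Rightarrow> 'a^'n \<Rightarrow> 'a^'n" where
  "dual_bracket y z = B (skew_op c r y) z + B y (skew_op c r z)"

lemma kappa_coboundary: "\<kappa> y (tensor_op (ad2 B x r) z) = - \<kappa> x (dual_bracket y z)"
proof -
  have "\<kappa> y (B x (skew_op c r z)) = - \<kappa> x (B y (skew_op c r z))"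
    using B_skew[of y x] by (simp add: kappa_invariant[symmetric] kappa_neg_left)
  moreover have "\<kappa> y (skew_op c r (B x z)) = \<kappa> x (B (skew_op c r y) z)"
    using kappa_skew_op[of y "B x z"] B_skew[of x "skew_op c r y"]
    by (simp add: kappa_invariant[symmetric] kappa_neg_left kappa_neg_right)
  ultimately show ?thesis
    by (simp add: tensor_op_ad2_skew_op dual_bracket_def kappa_diff_right kappa_add_right)
qed

context
  assumes cyb: "CYB B r = 0"
begin

lemma modified_CYBE:
  "B (skew_op c r y) (skew_op c r z) = skew_op c r (dual_bracket y z) - (c\<^sup>2 / 4) *s B y z"
proof -
  define S where "S = skew_op c r"
  have S: "tensor_op r x = S x + (c / 2) *s x" "tensor_op (flip r) x = (c / 2) *s x - S x" for x
    by (simp_all add: S_def skew_op_def tensor_op_flip_eq vec_eq_iff)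
  have S_add: "S (x + y) = S x + S y" and S_diff: "S (x - y) = S x - S y"
    and S_scale: "S (d *s x) = d *s S x" for x y d
    unfolding S_def by (simp_all add: lin_add lin_diff lin_scale skew_op_lin)
  \<comment> \<open>Inserting \<open>S + c / 2\<close> for the operator of \<open>r\<close> and
    \<open>c / 2 - S\<close> for that of \<open>flip r\<close>. All terms of first order in
    \<open>c\<close> cancel; of the three terms of second order the two on the right cancel, and the
    one on the left becomes the inhomogeneous term.\<close>
  have "B (S y) (S z) + (c / 2) *s (B (S y) z + B y (S z)) + (c\<^sup>2 / 4) *s B y z
     = S (B y (S z)) + (c / 2) *s S (B y z) + (c / 2) *s B y (S z) + (c\<^sup>2 / 4) *s B y z
     - ((c / 2) *s S (B y z) - S (B (S y) z) + (c\<^sup>2 / 4) *s B y z - (c / 2) *s B (S y) z)"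
    using CYB_op[OF cyb, of y z]
    by (simp add: S S_add S_diff S_scale B_add_left B_add_right B_scale_left B_scale_right
        B_diff_left vec.scale_right_distrib vec.scale_right_diff_distrib power2_eq_square
        algebra_simps)
  then show ?thesis
    unfolding S_def[symmetric] dual_bracket_def S_add
    by (simp add: vec_eq_iff algebra_simps)
qed

text \<open>The modified Yang-Baxter equation removes the nested \<open>S\<close>. The cyclic sum
  then splits into four Jacobi identities of \<open>B\<close>: one for each choice of two arguments
  carrying an \<open>S\<close>, and one multiplied by \<open>c^2 / 4\<close>.\<close>

lemma dual_bracket_jacobi:
  "dual_bracket x (dual_bracket y z) + dual_bracket y (dual_bracket z x)
    + dual_bracket z (dual_bracket x y) = 0"
proof -
  define S where "S = skew_op c r"
  have db: "dual_bracket x (dual_bracket y z) = B (S x) (B (S y) z) + B (S x) (B y (S z))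
      + B x (B (S y) (S z)) + (c\<^sup>2 / 4) *s B x (B y z)" for x y z
  proof -
    have "S (dual_bracket y z) = B (S y) (S z) + (c\<^sup>2 / 4) *s B y z"
      using modified_CYBE[of y z] by (simp add: S_def)
    then show ?thesis
      unfolding dual_bracket_def[of x] S_def[symmetric]
      by (simp add: dual_bracket_def S_def[symmetric] B_add_right B_scale_right)
  qed
  have J: "B a (B b d) + B b (B d a) + B d (B a b) = 0" for a b d
    using lie_jacobi[OF lie] .
  have Jc: "(c\<^sup>2 / 4) *s B x (B y z) + (c\<^sup>2 / 4) *s B y (B z x) + (c\<^sup>2 / 4) *s B z (B x y) = 0"
    unfolding vec.scale_right_distrib[symmetric] J by simp
  have "dual_bracket x (dual_bracket y z) + dual_bracket y (dual_bracket z x)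
      + dual_bracket z (dual_bracket x y)
    = (B (S x) (B (S y) z) + B (S y) (B z (S x)) + B z (B (S x) (S y)))
    + (B (S x) (B y (S z)) + B y (B (S z) (S x)) + B (S z) (B (S x) y))
    + (B x (B (S y) (S z)) + B (S y) (B (S z) x) + B (S z) (B x (S y)))
    + ((c\<^sup>2 / 4) *s B x (B y z) + (c\<^sup>2 / 4) *s B y (B z x) + (c\<^sup>2 / 4) *s B z (B x y))"
    unfolding db by (simp only: ac_simps)
  then show ?thesis
    by (simp only: J Jc add_0_right)
qed

text \<open>Pairing the co-Jacobi expression with three vectors, which is what \<open>p3\<close>
  does, turns it into the Jacobi identity of \<open>dual_bracket\<close>. Antisymmetry holds because
  the symmetric part of \<open>r\<close> is a multiple of the invariant \<Omega>, and the cocycle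
  condition because \<open>ad2\<close> is a Lie algebra action.\<close>

lemma coboundary_lie_bialgebra: "lie_bialgebra B (\<lambda>x. ad2 B x r)"
proof -
  define \<delta> where "\<delta> x = ad2 B x r" for x
  have \<delta>_lin: "lin \<delta>" unfolding \<delta>_def by (rule ad2_lin_left[OF lie])
  define p3 where "p3 y z w T = \<kappa> y (contr (\<lambda>t. \<kappa> z (tensor_op t w)) T)"
    for y z w and T :: "'a^('n \<times> 'n \<times> 'n)"
  have p3_add: "p3 y z w (s + t) = p3 y z w s + p3 y z w t" for y z w s t
    by (simp add: p3_def lin_add[OF contr_lin] kappa_add_right)
  have p3_tens: "p3 y z w (tens a t) = \<kappa> y a * \<kappa> z (tensor_op t w)" for y z w a t
    unfolding p3_def
    by (subst contr_tens)
      (simp_all add: tensor_op_add_left tensor_op_scale_left kappa_add_right kappa_scale_right)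
  have p3_tens3: "p3 y z w (tens a (tens b d)) = \<kappa> y a * \<kappa> z b * \<kappa> w d" for y z w a b d
    by (simp add: p3_tens tensor_op_tens kappa_scale_right kappa_sym[of d])
  have p3_cyc: "p3 y z w (cyc t) = p3 w y z t" for y z w t
    by (induction t rule: tens3_induct) (simp_all add: p3_add cyc_add p3_tens3)
  have p3_delta: "p3 y z w (tens_map id \<delta> t) = - \<kappa> y (tensor_op t (dual_bracket z w))" for y z w t
    by (induction t rule: tens_induct)
      (simp_all add: p3_add tens_map_add \<delta>_lin p3_tens tensor_op_add_left tensor_op_tens kappa_add_right
        kappa_scale_right, simp add: \<delta>_def kappa_coboundary)
  have p3_eqI: "T = 0" if "\<And>y z w. p3 y z w T = 0" for T
  proof -
    have "p3 (dual i) (dual k) (dual l) T = T $ (i, k, l)" for i k l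
      by (induction T rule: tens3_induct) (simp_all add: p3_tens3 p3_add kappa_dual)
    then show ?thesis using that by (simp add: vec_eq_iff)
  qed
  have "T + cyc T + cyc (cyc T) = 0" if T: "T = tens_map id \<delta> (\<delta> x)" for x T
  proof (rule p3_eqI)
    have p3_T: "p3 y z w T = \<kappa> x (dual_bracket y (dual_bracket z w))" for y z w
      unfolding T p3_delta by (simp add: \<delta>_def kappa_coboundary)
    show "p3 y z w (T + cyc T + cyc (cyc T)) = 0" for y z w
      using dual_bracket_jacobi[of y z w]
      by (simp add: p3_add p3_cyc p3_T kappa_add_right[symmetric] ac_simps kappa_scale_right[of _ 0 0, simplified])
  qed
  moreover have "flip (\<delta> x) = - \<delta> x" for x
    by (simp add: \<delta>_def ad2_flip[OF lie] ad2_flip_eq)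
  moreover have "\<delta> (B x y) = ad2 B x (\<delta> y) - ad2 B y (\<delta> x)" for x y
    by (simp add: \<delta>_def ad2_bracket[OF lie])
  ultimately show ?thesis
    using lie \<delta>_lin unfolding lie_bialgebra_def \<delta>_def[symmetric] Let_def by auto
qed

end

end


text \<open>To be applied with \<open>\<phi> = u \<gamma>\<close> and
  \<open>\<beta> = \<gamma> \<alpha>\<close>.\<close>

lemma invariant_proportional:
  assumes sym: "r + flip r = c *s \<Omega>" and "c \<noteq> 0" and cyb: "CYB B r = 0"
    and \<phi>: "\<phi> \<in> lie_aut B" and "\<alpha> \<noteq> 0"
    and inv: "\<And>y. \<beta> *s ad2 B y (tens_map \<phi> \<phi> r) = \<alpha> *s ad2 B y r"
  shows "(\<beta> = \<alpha> \<and> tens_map \<phi> \<phi> r = r) \<or> (\<beta> = - \<alpha> \<and> tens_map \<phi> \<phi> r = flip r)"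
proof -
  have lin: "lin \<phi>" and bij: "bij \<phi>" and hom: "\<And>x y. \<phi> (B x y) = B (\<phi> x) (\<phi> y)"
    using \<phi> by (auto simp: lie_aut_def lie_iso_def)
  define S where "S = skew_op c r"
  \<comment> \<open>The same \<open>c / 2\<close> is subtracted as for \<open>S\<close>: since
    \<phi> preserves the Killing form, \<open>S'\<close> is then the conjugate of \<open>S\<close>
    by \<phi>.\<close>
  define S' where "S' x = tensor_op (tens_map \<phi> \<phi> r) x - (c / 2) *s x" for x
  have S_lin: "lin S" unfolding S_def by (rule skew_op_lin)
  have S': "S' (\<phi> x) = \<phi> (S x)" for x
    by (simp add: S'_def S_def skew_op_def tensor_op_tens_map_aut[OF \<phi>] lin_diff[OF lin] lin_scale[OF lin])
  have S'_lin: "lin S'"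
    by (rule linI) (simp_all add: S'_def tensor_op_add tensor_op_scale vec.scale_right_distrib
        vec.scale_right_diff_distrib mult.commute)
  have S_skew: "\<kappa> (S x) y = - \<kappa> x (S y)" for x y
    unfolding S_def by (rule kappa_skew_op[OF sym])
  have S'_skew: "\<kappa> (S' x) y = - \<kappa> x (S' y)" for x y
  proof -
    obtain x' y' where "x = \<phi> x'" "y = \<phi> y'" using bij by (metis bij_pointE)
    then show ?thesis by (simp add: S' killing_form_aut[OF lie \<phi>] S_skew)
  qed
  have cybe: "B (S y) (S z) = S (B (S y) z + B y (S z)) - (c\<^sup>2 / 4) *s B y z" for y z
    using modified_CYBE[OF sym cyb, of y z] unfolding dual_bracket_def[OF sym] S_def .
  have cybe': "B (S' y) (S' z) = S' (B (S' y) z + B y (S' z)) - (c\<^sup>2 / 4) *s B y z" for y z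
  proof -
    obtain y' z' where yz: "y = \<phi> y'" "z = \<phi> z'" using bij by (metis bij_pointE)
    have "B (S' y) (S' z) = \<phi> (B (S y') (S z'))" by (simp add: yz S' hom)
    also have "\<dots> = S' (B (S' y) z + B y (S' z)) - (c\<^sup>2 / 4) *s B y z"
      unfolding cybe lin_diff[OF lin] lin_scale[OF lin] yz S' hom[symmetric] lin_add[OF lin, symmetric] ..
    finally show ?thesis .
  qed
  define T where "T x = \<beta> *s S' x - \<alpha> *s S x" for x
  have T_lin: "lin T"
    unfolding T_def by (rule linI) (simp_all add: lin_add[OF S_lin] lin_scale[OF S_lin]
        lin_add[OF S'_lin] lin_scale[OF S'_lin] vec.scale_right_distrib
        vec.scale_right_diff_distrib mult.commute)
  have "T (B x y) = B x (T y)" for x y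
  proof -
    have "tensor_op (\<beta> *s ad2 B x (tens_map \<phi> \<phi> r)) y = tensor_op (\<alpha> *s ad2 B x r) y"
      by (simp only: inv)
    then have "\<beta> *s (B x (S' y) - S' (B x y)) = \<alpha> *s (B x (S y) - S (B x y))"
      by (simp add: tensor_op_scale_left tensor_op_ad2 S'_def S_def skew_op_def B_diff_right B_scale_right)
    then show ?thesis
      by (simp add: T_def B_diff_right B_scale_right vec.scale_right_diff_distrib algebra_simps)
  qed
  then obtain \<mu> where \<mu>: "\<And>x. T x = \<mu> *s x"
    using centroid[OF T_lin] by blast
  have "\<mu> * \<kappa> x y = - (\<mu> * \<kappa> x y)" for x y
  proof -
    have "\<kappa> (T x) y = - \<kappa> x (T y)"
      by (simp add: T_def kappa_diff_left kappa_diff_right kappa_scale_left kappa_scale_right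
          S_skew S'_skew)
    then show ?thesis by (simp add: \<mu> kappa_scale_left kappa_scale_right)
  qed
  then have "\<mu> * \<kappa> x y = 0" for x y
    by (simp only: eq_neg_iff_add_eq_0 mult_2[symmetric]) simp
  \<comment> \<open>This nonzero bracket is the test vector twice: here nondegeneracy of the form
    kills \<mu>, and below the constant terms of the quadratic equations are compared on it.\<close>
  obtain x0 y0 where nab: "B x0 y0 \<noteq> 0" using nonabelian by blast
  have "\<mu> *s B x0 y0 = 0"
    by (rule kappa_nondegenerate)
      (simp only: kappa_scale_right \<open>\<And>x y. \<mu> * \<kappa> x y = 0\<close> killing_form_zero_right[OF lie])
  then have "\<mu> = 0" using nab by simp
  then have SS': "\<beta> *s S' x = \<alpha> *s S x" for x
    using \<mu>[of x] by (simp add: T_def)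
  have "\<beta>\<^sup>2 *s B (S' y) (S' z) = \<alpha>\<^sup>2 *s B (S y) (S z)" for y z
  proof -
    have "\<beta>\<^sup>2 *s B (S' y) (S' z) = B (\<beta> *s S' y) (\<beta> *s S' z)"
      by (simp add: B_scale_left B_scale_right power2_eq_square)
    then show ?thesis
      unfolding SS' by (simp add: B_scale_left B_scale_right power2_eq_square)
  qed
  moreover have "\<beta>\<^sup>2 *s S' (B (S' y) z + B y (S' z)) = \<alpha>\<^sup>2 *s S (B (S y) z + B y (S z))" for y z
  proof -
    have "\<beta>\<^sup>2 *s S' (B (S' y) z + B y (S' z)) = \<beta> *s S' (B (\<beta> *s S' y) z + B y (\<beta> *s S' z))"
      by (simp add: B_scale_left B_scale_right power2_eq_square lin_add[OF S'_lin]
          lin_scale[OF S'_lin] vec.scale_right_distrib)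
    then show ?thesis
      unfolding SS' by (simp add: B_scale_left B_scale_right power2_eq_square lin_add[OF S_lin]
          lin_scale[OF S_lin] vec.scale_right_distrib)
  qed
  \<comment> \<open>Apart from its constant term the quadratic equation is homogeneous of degree two
    in \<open>S\<close>, so scaling by the squares of \<alpha> and \<beta> isolates that
    term.\<close>
  ultimately have SS'2: "\<alpha>\<^sup>2 *s (S (B (S y) z + B y (S z)) - B (S y) (S z))
      = \<beta>\<^sup>2 *s (S' (B (S' y) z + B y (S' z)) - B (S' y) (S' z))" for y z
    by (simp only: vec.scale_right_diff_distrib)
  have "\<beta>\<^sup>2 *s ((c\<^sup>2 / 4) *s B y z) = \<alpha>\<^sup>2 *s ((c\<^sup>2 / 4) *s B y z)" for y z
  proof -
    have "S (B (S y) z + B y (S z)) - B (S y) (S z) = (c\<^sup>2 / 4) *s B y z"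
      "S' (B (S' y) z + B y (S' z)) - B (S' y) (S' z) = (c\<^sup>2 / 4) *s B y z"
      by (simp_all only: cybe cybe') simp_all
    then show ?thesis using SS'2[of y z, symmetric] by simp
  qed
  from this[of x0 y0] have "\<beta>\<^sup>2 = \<alpha>\<^sup>2"
    using nab \<open>c \<noteq> 0\<close> by simp
  then have "\<beta> = \<alpha> \<or> \<beta> = - \<alpha>"
    by (simp add: power2_eq_iff)
  then show ?thesis
  proof
    assume "\<beta> = \<alpha>"
    then have "S' x = S x" for x using SS'[of x] \<open>\<alpha> \<noteq> 0\<close> by simp
    then have "tens_map \<phi> \<phi> r = r"
      by (intro tensor_op_eqI) (simp add: S'_def S_def skew_op_def)
    then show ?thesis using \<open>\<beta> = \<alpha>\<close> by simp
  next
    assume "\<beta> = - \<alpha>"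
    then have "\<alpha> *s (S' x + S x) = 0" for x
      using SS'[of x, symmetric] by (simp only: vec.scale_right_distrib) simp
    then have "S' x = - S x" for x
      using \<open>\<alpha> \<noteq> 0\<close> by (simp only: eq_neg_iff_add_eq_0 vec.scale_eq_0_iff) simp
    \<comment> \<open>For the negative sign the transformed operator is \<open>c / 2 - S\<close>,
      which is the Killing adjoint of \<open>c / 2 + S\<close> and hence the operator of
      \<open>flip r\<close>.\<close>
    moreover have "tensor_op (tens_map \<phi> \<phi> r) x = S' x + (c / 2) *s x"
      "tensor_op (flip r) x = (c / 2) *s x - S x" for x
      by (simp_all add: S'_def S_def skew_op_def tensor_op_flip_eq[OF sym] vec_eq_iff)
    ultimately have "tensor_op (tens_map \<phi> \<phi> r) x = tensor_op (flip r) x" for x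
      by simp
    then have "tens_map \<phi> \<phi> r = flip r" by (rule tensor_op_eqI)
    then show ?thesis using \<open>\<beta> = - \<alpha>\<close> by simp
  qed
qed

lemma invariant_iff:
  assumes sym: "r + flip r = c *s \<Omega>" and "c \<noteq> 0" and "CYB B r = 0"
    and "\<phi> \<in> lie_aut B" and "\<alpha> \<noteq> 0"
  shows "(\<forall>y. \<beta> *s ad2 B y (tens_map \<phi> \<phi> r) = \<alpha> *s ad2 B y r) \<longleftrightarrow>
    (\<beta> = \<alpha> \<and> tens_map \<phi> \<phi> r = r) \<or> (\<beta> = - \<alpha> \<and> tens_map \<phi> \<phi> r = flip r)"
  using invariant_proportional[OF assms] ad2_flip_eq[OF sym] by auto

end

section \<open>Split simple Lie algebras over the rationals\<close>

text \<open>The spanning set of eigenvectors contains a basis, which is indexed by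
  \<open>'n\<close>; \<open>p\<close> passes from the coordinates in this eigenbasis to vectors, and
  \<open>q\<close> back.\<close>

lemma diagonalizable_conjugate:
  fixes f :: "'a::field^'n::finite \<Rightarrow> 'a^'n"
  assumes f: "lin f" and diag: "diagonalizable f"
  obtains p q :: "'a^'n \<Rightarrow> 'a^'n" and a where "lin p" "lin q" "\<And>x. q (p x) = x" "\<And>x. p (q x) = x"
    "\<And>x i. q (f x) $ i = a i * q x $ i"
proof -
  let ?E = "{v. \<exists>c. f v = c *s v}"
  obtain S where S: "S \<subseteq> ?E" "vec.independent S" "?E \<subseteq> vec.span S"
    by (rule vec.maximal_independent_subset)
  have span: "vec.span S = UNIV"
    using diag S(3) vec.span_minimal[OF S(3)] by (auto simp: diagonalizable_def)
  have "finite S" using S(2) by (rule vec.finiteI_independent)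
  have "card S = CARD('n)"
    using vec.basis_card_eq_dim[of S UNIV] S(2) span by (simp add: card_cart_basis)
  then obtain b where b: "bij_betw b (UNIV :: 'n set) S"
    using finite_same_card_bij[of "UNIV :: 'n set" S] \<open>finite S\<close> by auto
  have "\<exists>c. f (b i) = c *s b i" for i
    using b S(1) by (auto simp: bij_betw_def)
  then obtain a where a: "f (b i) = a i *s b i" for i by metis
  define p where "p x = (\<Sum>i\<in>UNIV. x $ i *s b i)" for x
  have p: "lin p"
    by (rule linI) (simp_all add: p_def vector_sadd_rdistrib sum.distrib vec.scale_sum_right)
  have "surj p"
    unfolding surj_def
  proof
    fix y
    have "y \<in> range (\<lambda>u. \<Sum>v\<in>S. u v *s v)"
      using span by (simp only: vec.span_finite[OF \<open>finite S\<close>] UNIV_I)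
    then obtain u where "y = (\<Sum>v\<in>S. u v *s v)" by (rule rangeE)
    also have "\<dots> = p (\<chi> i. u (b i))"
      unfolding p_def using sum.reindex_bij_betw[OF b, of "\<lambda>v. u v *s v"] by simp
    finally show "\<exists>x. y = p x" by blast
  qed
  then obtain q where q: "lin q" "\<And>x. q (p x) = x" "\<And>x. p (q x) = x"
    using vec.linear_surjective_isomorphism[OF p] by blast
  have "q (f (p x)) $ i = a i * x $ i" for x i
  proof -
    have "f (p x) = p (\<chi> i. a i * x $ i)"
      by (simp add: p_def lin_sum[OF f] lin_scale[OF f] a mult.commute)
    then show ?thesis by (simp add: q(2))
  qed
  from this[of "q _"] have "q (f x) $ i = a i * q x $ i" for x i
    by (simp add: q(3))
  then show ?thesis using that p q by blast
qed

text \<open>In eigen-coordinates the k-th power of an eigenvalue times a coordinate vanishes only if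
  one of the two does, or if k is 0 and the coordinate vanishes.\<close>

lemma diagonalizable_power_zero:
  fixes f :: "'a::field^'n::finite \<Rightarrow> 'a^'n"
  assumes f: "lin f" and "diagonalizable f" and "(f ^^ k) x = 0"
  shows "f x = 0"
proof -
  obtain p q :: "'a^'n \<Rightarrow> 'a^'n" and a where pq: "lin p" "lin q" "\<And>x. p (q x) = x"
    and a: "\<And>x i. q (f x) $ i = a i * q x $ i"
    using diagonalizable_conjugate[OF assms(1,2)] by metis
  have "q ((f ^^ k) x) $ i = a i ^ k * q x $ i" for i
    by (induction k) (simp_all add: a mult.assoc)
  then have "a i ^ k * q x $ i = 0" for i
    using assms(3) lin_zero[OF pq(2)] by (metis zero_index)
  then have "q (f x) $ i = 0" for i
    by (simp add: a) (metis mult_eq_0_iff power_eq_0_iff)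
  then have "q (f x) = 0" by (simp add: vec_eq_iff)
  then show ?thesis using pq lin_zero by metis
qed

text \<open>The trace is a sum of squares of eigenvalues; in an ordered field each of them has to
  vanish.\<close>

lemma diagonalizable_trace_square:
  fixes f :: "'a::linordered_field^'n::finite \<Rightarrow> 'a^'n"
  assumes f: "lin f" and "diagonalizable f" and tr: "trace (matrix (f \<circ> f)) = 0"
  shows "f x = 0"
proof -
  obtain p q :: "'a^'n \<Rightarrow> 'a^'n" and a where pq: "lin p" "lin q" "\<And>x. q (p x) = x" "\<And>x. p (q x) = x"
    and a: "\<And>x i. q (f x) $ i = a i * q x $ i"
    using diagonalizable_conjugate[OF assms(1,2)] by metis
  define d where "d = q \<circ> (f \<circ> (f \<circ> p))"
  have d_nth: "d x $ i = a i * (a i * x $ i)" for x i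
    by (simp add: d_def a pq)
  have lins: "lin (f \<circ> p)" "lin (f \<circ> (f \<circ> p))" "lin (f \<circ> f)"
    using lin_compose[OF f pq(1)] lin_compose[OF f lin_compose[OF f pq(1)]] lin_compose[OF f f]
    by (simp_all add: comp_def)
  have "matrix d = matrix q ** (matrix f ** (matrix f ** matrix p))"
    unfolding d_def by (simp only: matrix_compose_gen f pq lins)
  also have "\<dots> = matrix q ** (matrix (f \<circ> f) ** matrix p)"
    by (simp only: matrix_compose_gen[OF f f] matrix_mul_assoc)
  finally have "trace (matrix d) = trace ((matrix (f \<circ> f) ** matrix p) ** matrix q)"
    by (simp only: trace_mul_sym[of "matrix q"])
  also have "matrix (f \<circ> f) ** matrix p ** matrix q = matrix (f \<circ> f) ** (matrix (p \<circ> q))"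
    by (simp only: matrix_compose_gen[OF pq(2,1)] matrix_mul_assoc)
  also have "p \<circ> q = id" using pq by auto
  finally have "trace (matrix d) = 0"
    by (simp only: matrix_id_mat_1 matrix_mul_rid tr)
  moreover have "trace (matrix d) = (\<Sum>i\<in>UNIV. (a i)\<^sup>2)"
    by (simp add: trace_def matrix_def d_nth axis_def power2_eq_square)
  ultimately have "a i = 0" for i
    by (simp add: sum_nonneg_eq_0_iff)
  then have "q (f x) = 0" by (simp add: vec_eq_iff a)
  then show ?thesis using pq lin_zero by metis
qed

text \<open>A vector of \<open>W\<close> with minimal support in an eigenbasis is an eigenvector.\<close>

lemma diagonalizable_eigenvector:
  fixes f :: "'a::field^'n::finite \<Rightarrow> 'a^'n"
  assumes f: "lin f" and "diagonalizable f"
    and W: "\<And>x. x \<in> W \<Longrightarrow> f x \<in> W" "\<And>x y. x \<in> W \<Longrightarrow> y \<in> W \<Longrightarrow> x - y \<in> W"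
      "\<And>c x. x \<in> W \<Longrightarrow> c *s x \<in> W"
    and "w \<in> W" "w \<noteq> 0"
  obtains v c where "v \<in> W" "v \<noteq> 0" "f v = c *s v"
proof -
  obtain p q :: "'a^'n \<Rightarrow> 'a^'n" and a where pq: "lin p" "lin q" "\<And>x. p (q x) = x"
    and a: "\<And>x i. q (f x) $ i = a i * q x $ i"
    using diagonalizable_conjugate[OF assms(1,2)] by metis
  define supp where "supp x = {i. q x $ i \<noteq> 0}" for x
  obtain v where v: "v \<in> W" "v \<noteq> 0"
    and min: "\<And>y. y \<in> W \<Longrightarrow> y \<noteq> 0 \<Longrightarrow> card (supp v) \<le> card (supp y)"
    using ex_has_least_nat[of "\<lambda>x. x \<in> W \<and> x \<noteq> 0" w "\<lambda>x. card (supp x)"] assms(6,7) by blast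
  have "\<exists>i. q v $ i \<noteq> 0"
    using v pq lin_zero by (metis vec_eq_iff zero_index)
  then obtain i where i: "q v $ i \<noteq> 0" by blast
  define y where "y = f v - a i *s v"
  have qy: "q y $ k = (a k - a i) * q v $ k" for k
    by (simp add: y_def lin_diff[OF pq(2)] lin_scale[OF pq(2)] a left_diff_distrib)
  have "y \<in> W" unfolding y_def using W v by blast
  have "supp y \<subseteq> supp v" "i \<notin> supp y" "i \<in> supp v"
    using i by (auto simp: supp_def qy)
  then have "card (supp y) < card (supp v)"
    by (intro psubset_card_mono) auto
  then have "y = 0" using min[OF \<open>y \<in> W\<close>] by force
  then have "f v = a i *s v" by (simp add: y_def)
  then show ?thesis using that v by blast
qed

lemma cartan_subalgebra_normalizer:
  "cartan_subalgebra B H \<Longrightarrow> {x. \<forall>h\<in>H. B x h \<in> H} = H"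
  unfolding cartan_subalgebra_def by (elim conjE)

context
  fixes B :: "(rat, 'n::finite) bracket"
  assumes split: "split_simple B"
begin

lemma split_simple_lie: "lie_algebra B"
  and split_simple_nonabelian: "\<exists>x y. B x y \<noteq> 0"
  and split_simple_ideal: "lie_ideal B I \<Longrightarrow> I = {0} \<or> I = UNIV"
  using split by (auto simp: split_simple_def simple_lie_algebra_def)

lemma split_simple_center:
  assumes "\<And>y. B x y = 0"
  shows "x = 0"
proof -
  note lie = split_simple_lie
  let ?Z = "{x. \<forall>y. B x y = 0}"
  have "lie_ideal B ?Z"
    unfolding lie_ideal_def vec.subspace_def
  proof (intro conjI allI ballI impI)
    show "B z x \<in> ?Z" if "x \<in> ?Z" for x z
      using that lie_skew[OF lie, of z x] lie_zero_left[OF lie] by simp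
  qed (auto simp: lie_zero_left[OF lie] lie_add_left[OF lie] lie_scale_left[OF lie])
  then have "?Z = {0} \<or> ?Z = UNIV" by (rule split_simple_ideal)
  moreover have "?Z \<noteq> UNIV" using split_simple_nonabelian by blast
  ultimately show ?thesis using assms by blast
qed

text \<open>A Cartan subalgebra acting by zero would lie in the trivial center and so be
  \<open>{0}\<close>, but the normalizer of \<open>{0}\<close> is the whole algebra.\<close>

lemma split_simple_cartan:
  obtains H where "cartan_subalgebra B H" "\<And>h. h \<in> H \<Longrightarrow> diagonalizable (B h)"
    "\<exists>h\<in>H. \<exists>x. B h x \<noteq> 0"
proof -
  note lie = split_simple_lie
  obtain H where H: "cartan_subalgebra B H" "\<forall>h\<in>H. diagonalizable (B h)"
    using split unfolding split_simple_def by blast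
  have "\<exists>h\<in>H. \<exists>x. B h x \<noteq> 0"
  proof (rule ccontr)
    assume "\<not> ?thesis"
    then have *: "B h x = 0" if "h \<in> H" for h x
      using that by blast
    have "h = 0" if "h \<in> H" for h
      by (rule split_simple_center) (rule *[OF that])
    then have "H \<subseteq> {0}" by blast
    moreover have "0 \<in> H" using H(1) by (simp add: cartan_subalgebra_def vec.subspace_0)
    ultimately have "H = {0}" by blast
    have "{x. \<forall>h\<in>H. B x h \<in> H} = H"
      by (rule cartan_subalgebra_normalizer[OF H(1)])
    moreover have "{x. \<forall>h\<in>H. B x h \<in> H} = UNIV"
      using \<open>H = {0}\<close> lie_zero_right[OF lie] by simp
    ultimately have "(UNIV :: (rat^'n) set) = {0}"
      using \<open>H = {0}\<close> by (simp only:)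
    then have "x = 0" for x :: "rat^'n"
      by (metis UNIV_I singletonD)
    then show False using split_simple_nonabelian by blast
  qed
  then show ?thesis using that H by simp
qed

text \<open>
  By simplicity a degenerate Killing form vanishes, and for \<open>h\<close> in a split Cartan subalgebra over
  \<open>\<rat>\<close> the trace of \<open>ad\<^sub>h\<^sup>2\<close> is a sum of squares of rational eigenvalues.
\<close>

lemma split_simple_killing_nondegenerate:
  assumes "\<And>y. killing_form B x y = 0"
  shows "x = 0"
proof -
  note lie = split_simple_lie
  let ?R = "{x. \<forall>y. killing_form B x y = 0}"
  have "killing_form B (B z x) y = 0" if "x \<in> ?R" for x y z
    using that lie_skew[OF lie, of z x]
    by (simp add: killing_form_neg_left[OF lie] killing_form_invariant[OF lie])
  then have "lie_ideal B ?R"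
    unfolding lie_ideal_def vec.subspace_def
    by (auto simp: killing_form_add_left[OF lie] killing_form_scale_left[OF lie]
        killing_form_zero_left[OF lie])
  then have "?R = {0} \<or> ?R = UNIV" by (rule split_simple_ideal)
  moreover have "?R \<noteq> UNIV"
  proof
    assume R: "?R = UNIV"
    obtain H where "\<And>h. h \<in> H \<Longrightarrow> diagonalizable (B h)" "\<exists>h\<in>H. \<exists>x. B h x \<noteq> 0"
      using split_simple_cartan by metis
    then obtain h x where h: "diagonalizable (B h)" "B h x \<noteq> 0" by blast
    have "killing_form B h h = 0" using R by blast
    then show False
      using diagonalizable_trace_square[OF lie_lin(1)[OF lie] h(1), of x] h(2)
      by (simp add: killing_form_def)
  qed
  ultimately show ?thesis using assms by blast
qed

text \<open>\<open>matrix_inv\<close> is specified for invertible matrices only; the Gram matrix is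
  one because the Killing form has no radical.\<close>

lemma split_simple_casimir:
  "(\<Sum>k\<in>UNIV. casimir B $ (i, k) * killing_form B (axis k 1) b) = b $ i"
proof -
  note lie = split_simple_lie
  define G where "G = (\<chi> i j. killing_form B (axis i 1) (axis j 1))"
  have G: "(G *v x) $ i = killing_form B (axis i 1) x" for x i
  proof -
    have "killing_form B (axis i 1) x = killing_form B (axis i 1) (\<Sum>j\<in>UNIV. x $ j *s axis j 1)"
      by (simp only: axis_expansion[symmetric])
    then show ?thesis
      by (simp add: G_def matrix_vector_mult_def killing_form_sum_right[OF lie]
          killing_form_scale_right[OF lie] mult.commute)
  qed
  have "x = 0" if "G *v x = 0" for x
  proof -
    have 0: "killing_form B (axis i 1) x = 0" for i
      using G[of x i] that by simp
    have "killing_form B y x = 0" for y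
      by (induction y rule: vec_induct)
        (simp_all add: 0 killing_form_add_left[OF lie] killing_form_scale_left[OF lie])
    then show ?thesis
      using split_simple_killing_nondegenerate killing_form_sym[OF lie] by metis
  qed
  then have "\<exists>A. A ** G = mat 1"
    using matrix_left_invertible_ker[of G] by blast
  then have "invertible G" by (simp add: invertible_left_inverse)
  then have "matrix_inv G ** G = mat 1"
    unfolding invertible_def matrix_inv_def by (rule someI2_ex) simp
  then have "matrix_inv G *v (G *v b) = b" by (simp add: matrix_vector_mul_assoc)
  then have "(matrix_inv G *v (G *v b)) $ i = b $ i" by simp
  then show ?thesis
    unfolding matrix_vector_mult_def[of "matrix_inv G"]
    by (simp add: G casimir_def G_def[symmetric])
qed

text \<open>
  If \<open>h\<close> lies in a split Cartan subalgebra \<open>H\<close>, then so does \<open>T h\<close>, because \<open>H\<close> is abelian and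
  self-normalizing. Since \<open>ad\<^bsub>T h\<^esub> = T ad\<^sub>h\<close>, rational eigenvalues of \<open>ad\<^bsub>T h\<^esub>\<close> and \<open>ad\<^sub>h\<close> yield one of \<open>T\<close>.
\<close>

lemma split_simple_centroid:
  assumes T: "lin T" and comm: "\<And>x y. T (B x y) = B x (T y)"
  shows "\<exists>\<mu>. \<forall>x. T x = \<mu> *s x"
proof -
  note lie = split_simple_lie
  have comm': "B (T x) y = T (B x y)" for x y
    using comm[of y x] lie_skew[OF lie, of "T x" y] lie_skew[OF lie, of x y] lin_neg[OF T] by simp
  obtain H where H: "cartan_subalgebra B H" and diag: "\<And>h. h \<in> H \<Longrightarrow> diagonalizable (B h)"
    and ex: "\<exists>h\<in>H. \<exists>x. B h x \<noteq> 0"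
    using split_simple_cartan by metis
  \<comment> \<open>On \<open>H\<close> the map \<open>ad h\<close> is nilpotent by the lower
    central series; being diagonalizable on the whole algebra, it vanishes there.\<close>
  have abelian: "B h h' = 0" if hh: "h \<in> H" "h' \<in> H" for h h'
  proof -
    obtain k where k: "lower_central B H k = {0}"
      using H by (auto simp: cartan_subalgebra_def)
    have "(B h ^^ k) h' \<in> lower_central B H k" for k
    proof (induction k)
      case (Suc k)
      then show ?case using hh(1) by (auto intro!: vec.span_base)
    qed (simp add: hh)
    then have "(B h ^^ k) h' = 0" using k by blast
    then show ?thesis
      by (rule diagonalizable_power_zero[OF lie_lin(1)[OF lie] diag[OF hh(1)]])
  qed
  obtain h x0 where h: "h \<in> H" "B h x0 \<noteq> 0" using ex by blast
  have "0 \<in> H" using H by (simp add: cartan_subalgebra_def vec.subspace_0)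
  then have "T h \<in> {x. \<forall>h\<in>H. B x h \<in> H}"
    using abelian[OF h(1)] lin_zero[OF T] by (simp add: comm')
  moreover have "{x. \<forall>h\<in>H. B x h \<in> H} = H"
    by (rule cartan_subalgebra_normalizer[OF H])
  ultimately have "T h \<in> H" by (simp only:)
  have E: "B (T h) x = T (B h x)" "B (T h) x = B h (T x)" for x
    by (simp_all add: comm' comm)
  \<comment> \<open>Eigenvectors of \<open>ad (T h)\<close> span everything, so they cannot all lie
    in the kernel of \<open>ad h\<close>.\<close>
  have "\<exists>w e. B (T h) w = e *s w \<and> B h w \<noteq> 0"
  proof (rule ccontr)
    assume *: "\<not> ?thesis"
    have "vec.span {v. \<exists>c. B (T h) v = c *s v} \<subseteq> {v. B h v = 0}"
      by (rule vec.span_minimal)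
        (use * in \<open>auto simp: vec.subspace_def lie_add_right[OF lie] lie_scale_right[OF lie] lie_zero_right[OF lie]\<close>)
    then show False
      using diag[OF \<open>T h \<in> H\<close>] h(2) by (auto simp: diagonalizable_def)
  qed
  then obtain w e where w: "B (T h) w = e *s w" "B h w \<noteq> 0" by blast
  \<comment> \<open>If \<open>e = 0\<close>, then \<open>T\<close> kills the nonzero vector
    \<open>B h w\<close>. Otherwise the eigenspace of \<open>ad (T h)\<close> for \<open>e\<close>
    is stable under \<open>ad h\<close> and contains a common eigenvector \<open>v\<close>; from
    \<open>e *s v = c *s T v\<close> it follows that \<open>c\<close> is nonzero and that
    \<open>T\<close> has eigenvalue \<open>e / c\<close>.\<close>
  have "\<exists>v \<mu>. v \<noteq> 0 \<and> T v = \<mu> *s v"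
  proof (cases "e = 0")
    case True
    then have "T (B h w) = 0 *s B h w" using w(1) E by simp
    then show ?thesis using w(2) by blast
  next
    case False
    define W where "W = {y. B (T h) y = e *s y}"
    obtain v c where v: "v \<in> W" "v \<noteq> 0" "B h v = c *s v"
    proof (rule diagonalizable_eigenvector[OF lie_lin(1)[OF lie, of h] diag[OF h(1)]])
      show "B h x \<in> W" if "x \<in> W" for x
        using that E by (simp add: W_def) (metis lie_scale_right[OF lie])
      show "x - y \<in> W" if "x \<in> W" "y \<in> W" for x y
        using that by (simp add: W_def lie_diff_right[OF lie] vec.scale_right_diff_distrib)
      show "c *s x \<in> W" if "x \<in> W" for c x
        using that by (simp add: W_def lie_scale_right[OF lie] mult.commute)
      show "w \<in> W" "w \<noteq> 0"
        using w lie_zero_right[OF lie] by (auto simp: W_def)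
    qed
    have "e *s v = c *s T v"
      using v E(1)[of v] lin_scale[OF T] by (simp add: W_def)
    moreover from this have "c \<noteq> 0" using False v(2) by auto
    ultimately have "T v = (e / c) *s v"
      by (simp add: vec_eq_iff field_simps)
    then show ?thesis using v(2) by blast
  qed
  then obtain v \<mu> where v: "v \<noteq> 0" "T v = \<mu> *s v" by blast
  have "lie_ideal B {x. T x = \<mu> *s x}"
    unfolding lie_ideal_def vec.subspace_def
    by (auto simp: comm lin_zero[OF T] lin_add[OF T] lin_scale[OF T] lie_scale_right[OF lie]
        vec.scale_right_distrib mult.commute)
  then have "{x. T x = \<mu> *s x} = {0} \<or> {x. T x = \<mu> *s x} = UNIV"
    by (rule split_simple_ideal)
  then show ?thesis using v by blast
qed

end

section \<open>Scalar extension of Lie algebras\<close>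

lemma ext_vec_ext_vec: "ext_vec g (ext_vec h x) = ext_vec (\<lambda>z. g (h z)) x"
  by (simp add: ext_vec_def)

lemma ext_bracket_ext_bracket:
  assumes g: "field_hom g" and h: "field_hom h"
  shows "ext_bracket g (ext_bracket h B) = ext_bracket (\<lambda>z. g (h z)) B"
  unfolding ext_bracket_def[of g] ext_bracket_def[of "\<lambda>z. g (h z)"]
  by (simp add: ext_bracket_axis[OF h] ext_vec_ext_vec)

context
  fixes h :: "'a::field \<Rightarrow> 'b::field" and B :: "('a, 'n::finite) bracket"
  assumes h: "field_hom h" and lie: "lie_algebra B"
begin

abbreviation (input) "Bh \<equiv> ext_bracket h B"

lemmas ext_bracket_add_left = lin_add[OF ext_bracket_lin(2)[OF h]]
  and ext_bracket_add_right = lin_add[OF ext_bracket_lin(1)[OF h]]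
  and ext_bracket_scale_left = lin_scale[OF ext_bracket_lin(2)[OF h]]
  and ext_bracket_scale_right = lin_scale[OF ext_bracket_lin(1)[OF h]]

lemma ext_bracket_lie_ext_vec: "Bh (ext_vec h x) (ext_vec h y) = ext_vec h (B x y)"
  by (rule ext_bracket_ext_vec[OF h]) (rule lie_lin[OF lie])+

lemma ext_bracket_skew: "Bh x y = - Bh y x"
proof (induction x rule: vec_induct)
  case (axis c i)
  have "Bh (axis i 1) y = - Bh y (axis i 1)"
  proof (induction y rule: vec_induct)
    case (axis d k)
    have "ext_vec h (B (axis i 1) (axis k 1)) = - ext_vec h (B (axis k 1) (axis i 1))"
      by (subst lie_skew[OF lie]) (rule ext_vec_neg[OF h])
    then show ?case
      by (simp add: ext_bracket_scale_left ext_bracket_scale_right ext_bracket_axis[OF h])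
  qed (simp add: ext_bracket_add_left ext_bracket_add_right)
  then show ?case by (simp add: ext_bracket_scale_left ext_bracket_scale_right)
qed (simp add: ext_bracket_add_left ext_bracket_add_right)

lemma ext_bracket_self: "Bh x x = 0"
proof (induction x rule: vec_induct)
  case (axis c i)
  show ?case
    by (simp add: ext_bracket_scale_left ext_bracket_scale_right ext_bracket_axis[OF h] lie_self[OF lie]
        ext_vec_zero[OF h])
next
  case (add x y)
  then show ?case
    using ext_bracket_skew[of x y] by (simp add: ext_bracket_add_left ext_bracket_add_right)
qed

lemma ext_bracket_jacobi: "Bh x (Bh y z) + Bh y (Bh z x) + Bh z (Bh x y) = 0"
proof -
  define J where "J x y z = Bh x (Bh y z) + Bh y (Bh z x) + Bh z (Bh x y)" for x y z
  have J_add: "J (x + x') y z = J x y z + J x' y z" "J x (y + y') z = J x y z + J x y' z"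
    "J x y (z + z') = J x y z + J x y z'" for x x' y y' z z'
    by (simp_all add: J_def ext_bracket_add_left ext_bracket_add_right)
  have J_scale: "J (c *s x) y z = c *s J x y z" "J x (c *s y) z = c *s J x y z"
    "J x y (c *s z) = c *s J x y z" for c x y z
    by (simp_all add: J_def ext_bracket_scale_left ext_bracket_scale_right vec.scale_right_distrib)
  have J_axis: "J (axis i 1) (axis k 1) (axis l 1) = 0" for i k l
  proof -
    have "J (ext_vec h x) (ext_vec h y) (ext_vec h z) = 0" for x y z
      unfolding J_def ext_bracket_lie_ext_vec ext_vec_add[OF h, symmetric] lie_jacobi[OF lie]
      by (rule ext_vec_zero[OF h])
    from this[of "axis i 1" "axis k 1" "axis l 1"] show ?thesis
      by (simp add: ext_vec_axis[OF h])
  qed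
  have 1: "J (axis i 1) (axis k 1) z = 0" for i k z
    by (induction z rule: vec_induct) (simp_all add: J_add J_scale J_axis)
  have 2: "J (axis i 1) y z = 0" for i y z
    by (induction y rule: vec_induct) (simp_all add: J_add J_scale 1)
  have "J x y z = 0"
    by (induction x rule: vec_induct) (simp_all add: J_add J_scale 2)
  then show ?thesis by (simp add: J_def)
qed

lemma ext_bracket_lie_algebra: "lie_algebra Bh"
  unfolding lie_algebra_def
  using ext_bracket_lin[OF h] ext_bracket_self ext_bracket_jacobi by blast

lemma killing_form_ext_bracket:
  "killing_form Bh (ext_vec h x) (ext_vec h y) = h (killing_form B x y)"
proof -
  have *: "Bh (ext_vec h z) (axis k 1) = ext_vec h (B z (axis k 1))" for z k
    using ext_bracket_lie_ext_vec[of z "axis k 1"] by (simp add: ext_vec_axis[OF h])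
  show ?thesis
    unfolding killing_form_expand[OF lie] killing_form_expand[OF ext_bracket_lie_algebra] *
    by (simp add: ext_vec_nth[OF h] field_hom_sum[OF h] field_hom_mult[OF h])
qed

end

text \<open>Through \<open>h\<close> the big field is a rational vector space, in which the nonzero
  \<open>z\<close> can be completed to a basis.\<close>

lemma rational_functional:
  fixes h :: "rat \<Rightarrow> 'b::field" and z :: 'b
  assumes h: "field_hom h" and "z \<noteq> 0"
  obtains f :: "'b \<Rightarrow> rat" where "\<And>x y. f (x + y) = f x + f y" "\<And>q x. f (h q * x) = q * f x"
    "f z \<noteq> 0"
proof -
  let ?s = "\<lambda>q x. h q * x"
  interpret V: vector_space ?s
    by unfold_locales
      (simp_all add: distrib_left distrib_right field_hom_add[OF h] field_hom_mult[OF h]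
        field_hom_one[OF h] mult.assoc)
  interpret W: vector_space "(*) :: rat \<Rightarrow> rat \<Rightarrow> rat"
    by unfold_locales (simp_all add: algebra_simps)
  interpret P: vector_space_pair ?s "(*) :: rat \<Rightarrow> rat \<Rightarrow> rat" ..
  have "V.independent {z}"
    using \<open>z \<noteq> 0\<close> by (simp add: V.dependent_single)
  then obtain f where f: "Vector_Spaces.linear ?s (*) f" "f z = (1::rat)"
    using P.linear_independent_extend[of "{z}" "\<lambda>_. 1"] by auto
  then show ?thesis
    using that[of f] by (simp add: Vector_Spaces.linear_iff)
qed

text \<open>
  A \<open>\<rat>\<close>-linear functional on the big field turns \<open>T\<close> into an element of the centroid
  of the rational form; such functionals separate the matrix entries of \<open>T\<close>.
\<close>

lemma split_simple_ext_centroid: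
  fixes h :: "rat \<Rightarrow> 'b::field" and B :: "(rat, 'n::finite) bracket"
  assumes h: "field_hom h" and split: "split_simple B" and T: "lin T"
    and comm: "\<And>x y. T (ext_bracket h B x y) = ext_bracket h B x (T y)"
  shows "\<exists>\<mu>. \<forall>x. T x = \<mu> *s x"
proof -
  note lie = split_simple_lie[OF split]
  have key: "\<exists>\<mu>. \<forall>i k. f (T (axis k 1) $ i) = (if i = k then \<mu> else 0)"
    if f: "\<And>x y. f (x + y) = f x + f y" "\<And>q x. f (h q * x) = q * f x" for f :: "'b \<Rightarrow> rat"
  proof -
    define F where "F = (ext_vec f :: 'b^'n \<Rightarrow> rat^'n)"
    have F_add: "F (x + y) = F x + F y" and F_scale: "F (h q *s x) = q *s F x" for x y q
      by (simp_all add: F_def ext_vec_def vec_eq_iff f)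
    have F_B: "F (ext_bracket h B (ext_vec h x) y) = B x (F y)" for x y
    proof (induction y rule: vec_induct)
      case (axis c i)
      have "F (c *s axis i 1) = f c *s axis i 1"
        using f(2)[of 0 0] field_hom_zero[OF h] by (simp add: F_def ext_vec_def vec_eq_iff axis_def)
      moreover have "F (c *s ext_vec h z) = f c *s z" for z
        by (simp add: F_def ext_vec_def vec_eq_iff f mult.commute[of c] mult.commute[of "f c"])
      ultimately show ?case
        using ext_bracket_lie_ext_vec[OF h lie, of x "axis i 1"]
        by (simp add: ext_bracket_scale_right[OF h lie] lie_scale_right[OF lie] ext_vec_axis[OF h])
    qed (simp add: ext_bracket_add_right[OF h lie] F_add lie_add_right[OF lie])
    define T' where "T' x = F (T (ext_vec h x))" for x
    have "lin T'"
      by (rule linI) (simp_all add: T'_def ext_vec_add[OF h] ext_vec_scale[OF h] lin_add[OF T]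
          lin_scale[OF T] F_add F_scale)
    moreover have "T' (B x y) = B x (T' y)" for x y
      unfolding T'_def ext_bracket_lie_ext_vec[OF h lie, symmetric] comm F_B ..
    ultimately obtain \<mu> where "\<And>x. T' x = \<mu> *s x"
      using split_simple_centroid[OF split] by blast
    then have "F (T (axis k 1)) = \<mu> *s axis k 1" for k
      using ext_vec_axis[OF h, of k] by (metis T'_def)
    then have "f (T (axis k 1) $ i) = \<mu> * axis k 1 $ i" for i k
      unfolding F_def ext_vec_def by (simp add: vec_eq_iff)
    then show ?thesis by (intro exI[of _ \<mu>]) (simp add: axis_one_nth)
  qed
  have off: "T (axis k 1) $ i = 0" if "i \<noteq> k" for i k
  proof (rule ccontr)
    assume "T (axis k 1) $ i \<noteq> 0"
    then show False
      using rational_functional[OF h] key that by (metis (full_types))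
  qed
  have diag: "T (axis k 1) $ k = T (axis l 1) $ l" for k l
  proof (rule ccontr)
    assume "T (axis k 1) $ k \<noteq> T (axis l 1) $ l"
    then have "T (axis k 1) $ k - T (axis l 1) $ l \<noteq> 0" by simp
    then obtain f :: "'b \<Rightarrow> rat" where f: "\<And>x y. f (x + y) = f x + f y" "\<And>q x. f (h q * x) = q * f x"
      "f (T (axis k 1) $ k - T (axis l 1) $ l) \<noteq> 0"
      by (rule rational_functional[OF h]) blast
    have "f (T (axis k 1) $ k) = f (T (axis l 1) $ l)"
      using key[OF f(1,2)] by (metis (full_types))
    then show False
      using f(1)[of "T (axis k 1) $ k - T (axis l 1) $ l" "T (axis l 1) $ l"] f(3) by simp
  qed
  fix l :: 'n
  have "T x = (T (axis l 1) $ l) *s x" for x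
  proof (rule lin_eqI[OF T])
    show "lin (\<lambda>x. (T (axis l 1) $ l) *s x)"
      by (rule linI) (simp_all add: vec.scale_right_distrib mult.commute)
    show "T (axis k 1) = (T (axis l 1) $ l) *s axis k 1" for k
      using off[of _ k] diag[of k l] by (auto simp: vec_eq_iff axis_one_nth)
  qed
  then show ?thesis by blast
qed

lemma split_simple_ext_casimir_lie_algebra:
  fixes h :: "rat \<Rightarrow> 'b::field_char_0" and B :: "(rat, 'n::finite) bracket"
  assumes h: "field_hom h" and split: "split_simple B"
  shows "casimir_lie_algebra (ext_bracket h B) (ext_vec h (casimir B))"
proof
  note lie = split_simple_lie[OF split]
  note lie' = ext_bracket_lie_algebra[OF h lie]
  show "lie_algebra (ext_bracket h B)" by (rule lie')
  show "(\<Sum>k\<in>UNIV. ext_vec h (casimir B) $ (i, k) * killing_form (ext_bracket h B) (axis k 1) b) = b $ i"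
    for i b
  proof (induction b rule: vec_induct)
    case (axis c l)
    have "killing_form (ext_bracket h B) (axis k 1) (axis l 1) = h (killing_form B (axis k 1) (axis l 1))" for k
      using killing_form_ext_bracket[OF h lie, of "axis k 1" "axis l 1"] by (simp add: ext_vec_axis[OF h])
    then have "(\<Sum>k\<in>UNIV. ext_vec h (casimir B) $ (i, k) * killing_form (ext_bracket h B) (axis k 1) (axis l 1))
       = h (\<Sum>k\<in>UNIV. casimir B $ (i, k) * killing_form B (axis k 1) (axis l 1))"
      by (simp add: ext_vec_nth[OF h] field_hom_sum[OF h] field_hom_mult[OF h])
    also have "\<dots> = axis l 1 $ i"
      unfolding split_simple_casimir[OF split]
      by (simp add: axis_one_nth field_hom_zero[OF h] field_hom_one[OF h])
    finally show ?case
      by (simp add: killing_form_scale_right[OF lie'] mult.left_commute[of _ c] sum_distrib_left[symmetric])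
  qed (simp add: killing_form_add_right[OF lie'] distrib_left sum.distrib)
  show "\<exists>\<mu>. \<forall>x. T x = \<mu> *s x"
    if "lin T" "\<And>x y. T (ext_bracket h B x y) = ext_bracket h B x (T y)" for T
    by (rule split_simple_ext_centroid[OF h split that])
  obtain x y where "B x y \<noteq> 0" using split_simple_nonabelian[OF split] by blast
  then show "\<exists>x y. ext_bracket h B x y \<noteq> 0"
    using ext_bracket_lie_ext_vec[OF h lie, of x y] ext_vec_eq_zero[OF h] by metis
qed

section \<open>The fixed field of the absolute Galois group\<close>

text \<open>Graphs of homomorphisms over \<open>K\<close> from subfields of the algebraic closure to the closure.\<close>

definition partial_hom :: "('k::field alg_closure \<times> 'k alg_closure) set \<Rightarrow> bool" where
  "partial_hom G \<longleftrightarrow> (\<forall>k. (to_ac k, to_ac k) \<in> G) \<and> (\<forall>b. (0, b) \<in> G \<longrightarrow> b = 0) \<and>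
     (\<forall>a b a' b'. (a, b) \<in> G \<longrightarrow> (a', b') \<in> G \<longrightarrow> (a + a', b + b') \<in> G \<and> (a * a', b * b') \<in> G)"

text \<open>\<open>g\<close> arises from \<open>f\<close> by applying the partial homomorphism to
  the coefficients; it is a relation because \<open>G\<close> need not be defined on all of
  them.\<close>

definition poly_rel :: "('a::zero \<times> 'a) set \<Rightarrow> 'a poly \<Rightarrow> 'a poly \<Rightarrow> bool" where
  "poly_rel G f g \<longleftrightarrow> (\<forall>n. (Polynomial.coeff f n, Polynomial.coeff g n) \<in> G)"

context
  fixes G :: "('k::field alg_closure \<times> 'k alg_closure) set"
  assumes G: "partial_hom G"
begin

lemma ph_scalar: "(to_ac k, to_ac k) \<in> G"
  and ph_zero: "(0, b) \<in> G \<Longrightarrow> b = 0"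
  and ph_add: "(a, b) \<in> G \<Longrightarrow> (a', b') \<in> G \<Longrightarrow> (a + a', b + b') \<in> G"
  and ph_mult: "(a, b) \<in> G \<Longrightarrow> (a', b') \<in> G \<Longrightarrow> (a * a', b * b') \<in> G"
  using G by (auto simp: partial_hom_def)

lemma ph_00: "(0, 0) \<in> G" and ph_11: "(1, 1) \<in> G"
  using ph_scalar[of 0] ph_scalar[of 1] by simp_all

lemma ph_diff: "(a, b) \<in> G \<Longrightarrow> (a', b') \<in> G \<Longrightarrow> (a - a', b - b') \<in> G"
  using ph_add[of a b "- a'" "- b'"] ph_mult[of "-1" "-1" a' b'] ph_scalar[of "-1"] by simp

text \<open>Subtracting two pairs shows why \<open>partial_hom\<close> demands single-valuedness at
  0 only.\<close>

lemma ph_unique: "(a, b) \<in> G \<Longrightarrow> (a, b') \<in> G \<Longrightarrow> b = b'"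
  using ph_diff[of a b a b'] ph_zero[of "b - b'"] by simp

lemma ph_sum: "(\<And>i. i \<in> I \<Longrightarrow> (f i, g i) \<in> G) \<Longrightarrow> (sum f I, sum g I) \<in> G"
  by (induction I rule: infinite_finite_induct) (simp_all add: ph_00 ph_add)

lemma ph_poly: "(a, b) \<in> G \<Longrightarrow> (poly (map_poly to_ac q) a, poly (map_poly to_ac q) b) \<in> G"
  by (induction q) (simp_all add: ph_00 ph_add ph_mult ph_scalar map_poly_pCons)

text \<open>Closure under inverses comes from algebraicity: factors X are cancelled from an
  annihilating polynomial until its constant coefficient is nonzero, and then the inverse of
  \<open>a\<close> is a polynomial in \<open>a\<close> over K.\<close>

lemma ph_inverse:
  assumes ab: "(a, b) \<in> G" and "a \<noteq> 0"
  shows "(inverse a, inverse b) \<in> G"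
proof -
  have "\<exists>q. a * poly (map_poly to_ac q) a = 1"
    if "p \<noteq> 0" "poly (map_poly to_ac p) a = 0" for p :: "'k poly"
    using that
  proof (induction p)
    case (pCons c p)
    show ?case
    proof (cases "c = 0")
      case True
      then show ?thesis using pCons \<open>a \<noteq> 0\<close> by (simp add: map_poly_pCons)
    next
      case False
      have *: "map_poly to_ac (Polynomial.smult (- inverse c) p) = Polynomial.smult (- inverse (to_ac c)) (map_poly to_ac p)"
        by (rule poly_eqI) (simp add: coeff_map_poly)
      have "a * poly (map_poly to_ac p) a = - to_ac c"
        using pCons.prems by (simp add: map_poly_pCons add_eq_0_iff)
      then have "a * poly (map_poly to_ac (Polynomial.smult (- inverse c) p)) a = 1"
        unfolding * using False by (simp add: field_simps)
      then show ?thesis by blast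
    qed
  qed simp
  then obtain q where q: "a * poly (map_poly to_ac q) a = 1"
    using alg_closure_algebraic[of a] by metis
  have "(1, b * poly (map_poly to_ac q) b) \<in> G"
    using ph_mult[OF ab ph_poly[OF ab, of q]] q by simp
  then have "b * poly (map_poly to_ac q) b = 1"
    using ph_unique ph_11 by blast
  then show ?thesis
    using ph_poly[OF ab, of q] q by (metis inverse_unique)
qed

lemma ph_inj: "(a, 0) \<in> G \<Longrightarrow> a = 0"
  using ph_mult[of a 0 "inverse a" "inverse 0"] ph_inverse[of a 0] ph_unique[OF ph_11, of 0]
  by (cases "a = 0") auto

lemma ph_divide: "(a, b) \<in> G \<Longrightarrow> (a', b') \<in> G \<Longrightarrow> a' \<noteq> 0 \<Longrightarrow> (a / a', b / b') \<in> G"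
  using ph_mult[OF _ ph_inverse] by (simp add: divide_inverse)

section \<open>Adjoining a root to a partial homomorphism\<close>

lemma poly_rel_add: "poly_rel G f g \<Longrightarrow> poly_rel G f' g' \<Longrightarrow> poly_rel G (f + f') (g + g')"
  by (simp add: poly_rel_def ph_add)

lemma poly_rel_diff: "poly_rel G f g \<Longrightarrow> poly_rel G f' g' \<Longrightarrow> poly_rel G (f - f') (g - g')"
  by (simp add: poly_rel_def ph_diff)

lemma poly_rel_mult: "poly_rel G f g \<Longrightarrow> poly_rel G f' g' \<Longrightarrow> poly_rel G (f * f') (g * g')"
  by (simp add: poly_rel_def coeff_mult ph_sum ph_mult)

lemma poly_rel_monom: "(a, b) \<in> G \<Longrightarrow> poly_rel G (Polynomial.monom a n) (Polynomial.monom b n)"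
  by (simp add: poly_rel_def ph_00)

lemma poly_rel_map_poly: "poly_rel G (map_poly to_ac q) (map_poly to_ac q)"
  by (simp add: poly_rel_def coeff_map_poly ph_scalar)

lemma poly_rel_zero: "poly_rel G 0 g \<Longrightarrow> g = 0"
  using ph_zero by (simp add: poly_rel_def poly_eq_iff)

lemma poly_rel_degree: "poly_rel G f g \<Longrightarrow> Polynomial.degree f = Polynomial.degree g"
proof -
  assume "poly_rel G f g"
  then have "Polynomial.coeff f n = 0 \<longleftrightarrow> Polynomial.coeff g n = 0" for n
    using ph_zero ph_inj by (metis poly_rel_def)
  then show ?thesis by (simp add: degree_def)
qed

text \<open>\<open>p\<close> acts as the minimal polynomial of \<open>z\<close> over the domain of
  \<open>G\<close>. Dividing \<open>f\<close> by \<open>p\<close> and, in parallel, \<open>g\<close>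
  by \<open>p'\<close> shows that \<open>f(z) = 0\<close> implies \<open>g(w) = 0\<close>, which
  makes the assignment of \<open>g(w)\<close> to \<open>f(z)\<close> well defined.\<close>

lemma partial_hom_extend_root:
  assumes p: "poly_rel G p p'" "p \<noteq> 0" "poly p z = 0"
    and min: "\<And>f g. poly_rel G f g \<Longrightarrow> f \<noteq> 0 \<Longrightarrow> poly f z = 0 \<Longrightarrow> Polynomial.degree p \<le> Polynomial.degree f"
    and w: "poly p' w = 0"
  shows "\<exists>G'. partial_hom G' \<and> G \<subseteq> G' \<and> (z, w) \<in> G'"
proof -
  have root: "poly g w = 0" if "poly_rel G f g" "poly f z = 0" for f g
    using that
  proof (induction "Polynomial.degree f" arbitrary: f g rule: less_induct)
    case less
    show ?case
    proof (cases "f = 0")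
      case True
      then show ?thesis using less.prems poly_rel_zero by (metis poly_0)
    next
      case False
      have deg: "Polynomial.degree p \<le> Polynomial.degree f" using min less.prems False by blast
      \<comment> \<open>One step of the two parallel divisions: the leading terms are cancelled with
        quotients \<open>a\<close> and \<open>a'\<close> that are again related by
        \<open>G\<close>.\<close>
      define a where "a = Polynomial.lead_coeff f / Polynomial.lead_coeff p"
      define a' where "a' = Polynomial.lead_coeff g / Polynomial.lead_coeff p'"
      define d where "d = Polynomial.degree f - Polynomial.degree p"
      have "(a, a') \<in> G"
        unfolding a_def a'_def using less.prems(1) p(1,2)
        by (intro ph_divide) (auto simp: poly_rel_def poly_rel_degree[OF p(1)] poly_rel_degree[OF less.prems(1)]
            simp flip: poly_rel_degree[OF p(1)] poly_rel_degree[OF less.prems(1)])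
      define f1 where "f1 = f - Polynomial.monom a d * p"
      define g1 where "g1 = g - Polynomial.monom a' d * p'"
      have rel: "poly_rel G f1 g1"
        unfolding f1_def g1_def
        by (intro poly_rel_diff poly_rel_mult poly_rel_monom less.prems p \<open>(a, a') \<in> G\<close>)
      have f1z: "poly f1 z = 0"
        using less.prems p by (simp add: f1_def)
      have "f1 = 0 \<or> Polynomial.degree f1 < Polynomial.degree f"
      proof (cases "Polynomial.degree f = 0")
        case True
        then obtain e where "f = [:e:]" using degree_eq_zeroE by blast
        then have False using less.prems(2) False by simp
        then show ?thesis ..
      next
        case df: False
        have mdeg: "Polynomial.degree (Polynomial.monom a d * p) \<le> Polynomial.degree f"
          using degree_mult_le[of "Polynomial.monom a d" p] degree_monom_le[of a d] deg
          unfolding d_def by linarith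
        have "Polynomial.coeff (Polynomial.monom a d * p) (Polynomial.degree f) = a * Polynomial.lead_coeff p"
          using deg by (simp add: coeff_monom_mult d_def)
        then have c: "Polynomial.coeff f1 (Polynomial.degree f) = 0"
          using p(2) by (simp add: f1_def a_def)
        have "Polynomial.degree f1 \<le> Polynomial.degree f"
          unfolding f1_def by (rule degree_diff_le[OF order_refl mdeg])
        then show ?thesis
          using c df by (metis le_neq_implies_less leading_coeff_0_iff)
      qed
      then have "poly g1 w = 0"
        using less.hyps rel f1z poly_rel_zero by (metis poly_0)
      then show ?thesis using w by (simp add: g1_def)
    qed
  qed
  define G' where "G' = {(poly f z, poly g w) | f g. poly_rel G f g}"
  have "partial_hom G'"
    unfolding partial_hom_def
  proof (intro conjI allI impI)
    show "(to_ac k, to_ac k) \<in> G'" for k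
      unfolding G'_def using poly_rel_monom[OF ph_scalar[of k], of 0]
      by (force simp: poly_monom)
    show "b = 0" if "(0, b) \<in> G'" for b
      using that root by (auto simp: G'_def)
    show "(a + a', b + b') \<in> G'" "(a * a', b * b') \<in> G'"
      if ab: "(a, b) \<in> G'" "(a', b') \<in> G'" for a b a' b'
    proof -
      obtain f g f' g' where *: "poly_rel G f g" "poly_rel G f' g'"
        "a = poly f z" "b = poly g w" "a' = poly f' z" "b' = poly g' w"
        using ab by (auto simp: G'_def)
      then show "(a + a', b + b') \<in> G'" "(a * a', b * b') \<in> G'"
        unfolding G'_def
        by (force intro: exI[of _ "f + f'"] exI[of _ "g + g'"] poly_rel_add,
            force intro: exI[of _ "f * f'"] exI[of _ "g * g'"] poly_rel_mult)
    qed
  qed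
  moreover have "G \<subseteq> G'"
  proof
    fix x assume "x \<in> G"
    then have "poly_rel G (Polynomial.monom (fst x) 0) (Polynomial.monom (snd x) 0)"
      by (simp add: poly_rel_monom)
    then show "x \<in> G'" unfolding G'_def by (cases x) (force simp: poly_monom)
  qed
  moreover have "(z, w) \<in> G'"
    unfolding G'_def using poly_rel_monom[OF ph_11, of 1] by (force simp: poly_monom)
  ultimately show ?thesis by blast
qed

lemma exists_minimal_poly_rel:
  "\<exists>p p'. poly_rel G p p' \<and> p \<noteq> 0 \<and> poly p z = 0 \<and>
    (\<forall>f g. poly_rel G f g \<longrightarrow> f \<noteq> 0 \<longrightarrow> poly f z = 0 \<longrightarrow> Polynomial.degree p \<le> Polynomial.degree f)"
proof -
  let ?P = "\<lambda>p. (\<exists>p'. poly_rel G p p') \<and> p \<noteq> 0 \<and> poly p z = 0"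
  obtain q :: "'k poly" where "q \<noteq> 0" "poly (map_poly to_ac q) z = 0"
    by (rule alg_closure_algebraic)
  then have "?P (map_poly to_ac q)"
    using poly_rel_map_poly by (auto simp: map_poly_eq_0_iff)
  then obtain p where "?P p" "\<And>f. ?P f \<Longrightarrow> Polynomial.degree p \<le> Polynomial.degree f"
    using ex_has_least_nat[of ?P _ Polynomial.degree] by blast
  then show ?thesis by blast
qed

lemma partial_hom_extend: "\<exists>G' w. partial_hom G' \<and> G \<subseteq> G' \<and> (z, w) \<in> G'"
proof -
  obtain p p' where p: "poly_rel G p p'" "p \<noteq> 0" "poly p z = 0"
    "\<And>f g. poly_rel G f g \<Longrightarrow> f \<noteq> 0 \<Longrightarrow> poly f z = 0 \<Longrightarrow> Polynomial.degree p \<le> Polynomial.degree f"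
    using exists_minimal_poly_rel[of z] by blast
  have "Polynomial.degree p > 0"
    using p(2,3) by (metis degree_eq_zeroE gr0I pCons_eq_0_iff poly_const_conv)
  then obtain w where "poly p' w = 0"
    using alg_closed_imp_poly_has_root poly_rel_degree[OF p(1)] by metis
  then show ?thesis using partial_hom_extend_root[OF p(1-3), of w] p(4) by blast
qed

end

text \<open>A graph that is maximal by Zorn's lemma is total, as it could otherwise be extended by
  one more element.\<close>

lemma partial_hom_extend_automorphism:
  fixes G :: "('k::field alg_closure \<times> 'k alg_closure) set"
  assumes G: "partial_hom G"
  shows "\<exists>\<gamma>\<in>GalK. \<forall>(a, b)\<in>G. \<gamma> a = b"
proof -
  define A where "A = {G'. partial_hom G' \<and> G \<subseteq> G'}"
  have "\<exists>M\<in>A. \<forall>Z\<in>A. M \<subseteq> Z \<longrightarrow> Z = M"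
  proof (rule subset_Zorn_nonempty)
    show "A \<noteq> {}" using G by (auto simp: A_def)
    fix C assume "C \<noteq> {}" and C: "subset.chain A C"
    have ph: "partial_hom Z" "G \<subseteq> Z" if "Z \<in> C" for Z
      using C that by (auto simp: subset_chain_def A_def)
    have two: "\<exists>Z\<in>C. x \<in> Z \<and> y \<in> Z" if xy: "x \<in> \<Union>C" "y \<in> \<Union>C" for x y
    proof -
      obtain Z Y where XY: "Z \<in> C" "x \<in> Z" "Y \<in> C" "y \<in> Y" using xy by blast
      then have "Z \<subseteq> Y \<or> Y \<subseteq> Z" using C by (auto simp: subset_chain_def)
      then show ?thesis using XY by blast
    qed
    obtain Z0 where "Z0 \<in> C" using \<open>C \<noteq> {}\<close> by blast
    have "partial_hom (\<Union>C)"
      unfolding partial_hom_def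
    proof (intro conjI allI impI)
      show "(to_ac k, to_ac k) \<in> \<Union>C" for k
        using \<open>Z0 \<in> C\<close> ph_scalar[OF ph(1)[OF \<open>Z0 \<in> C\<close>]] by blast
      show "b = 0" if "(0, b) \<in> \<Union>C" for b
        using that ph_zero[OF ph(1)] by blast
      fix a b a' b' assume "(a, b) \<in> \<Union>C" "(a', b') \<in> \<Union>C"
      then obtain Z where Z: "Z \<in> C" "(a, b) \<in> Z" "(a', b') \<in> Z"
        using two by blast
      show "(a + a', b + b') \<in> \<Union>C" "(a * a', b * b') \<in> \<Union>C"
        using ph_add[OF ph(1) Z(2,3)] ph_mult[OF ph(1) Z(2,3)] Z(1) by auto
    qed
    then show "\<Union>C \<in> A" using ph(2)[OF \<open>Z0 \<in> C\<close>] \<open>Z0 \<in> C\<close> by (auto simp: A_def)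
  qed
  then obtain M where "M \<in> A" and max: "\<forall>Y\<in>A. M \<subseteq> Y \<longrightarrow> Y = M"
    by (rule bexE)
  then have M: "partial_hom M" and GM: "G \<subseteq> M"
    by (simp_all add: A_def)
  have "\<exists>b. (a, b) \<in> M" for a
  proof -
    obtain Z w where Z: "partial_hom Z" "M \<subseteq> Z" "(a, w) \<in> Z"
      using partial_hom_extend[OF M, of a] by blast
    then have "Z \<in> A" using GM by (simp add: A_def)
    then have "Z = M" using max Z(2) by simp
    then show ?thesis using Z(3) by blast
  qed
  then obtain \<gamma> where \<gamma>: "(a, \<gamma> a) \<in> M" for a by metis
  have eq: "\<gamma> a = b" if "(a, b) \<in> M" for a b
    using ph_unique[OF M \<gamma> that] .
  have add: "\<gamma> (x + y) = \<gamma> x + \<gamma> y" for x y by (rule eq) (rule ph_add[OF M \<gamma> \<gamma>])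
  have mult: "\<gamma> (x * y) = \<gamma> x * \<gamma> y" for x y by (rule eq) (rule ph_mult[OF M \<gamma> \<gamma>])
  have fix_K: "\<gamma> (to_ac k) = to_ac k" for k by (rule eq) (rule ph_scalar[OF M])
  have inj: "inj \<gamma>"
  proof (rule injI)
    fix x y assume "\<gamma> x = \<gamma> y"
    then have "(x - y, 0) \<in> M" using ph_diff[OF M \<gamma>[of x] \<gamma>[of y]] by simp
    then show "x = y" using ph_inj[OF M] by force
  qed
  have poly_\<gamma>: "\<gamma> (poly (map_poly to_ac q) x) = poly (map_poly to_ac q) (\<gamma> x)" for q :: "'k poly" and x
    by (rule eq) (rule ph_poly[OF M \<gamma>])
  \<comment> \<open>Every element is a root of a polynomial over K, and the injective \<gamma>
    permutes the finitely many roots of such a polynomial.\<close>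
  have "surj \<gamma>"
    unfolding surj_def
  proof
    fix y
    obtain q :: "'k poly" where q: "q \<noteq> 0" "poly (map_poly to_ac q) y = 0"
      by (rule alg_closure_algebraic)
    let ?R = "{x. poly (map_poly to_ac q) x = 0}"
    have "finite ?R" using q(1) by (intro poly_roots_finite) (simp add: map_poly_eq_0_iff)
    moreover have "\<gamma> ` ?R \<subseteq> ?R"
    proof clarify
      fix x assume "poly (map_poly to_ac q) x = 0"
      then show "poly (map_poly to_ac q) (\<gamma> x) = 0"
        using poly_\<gamma>[of q x] fix_K[of 0] by (simp only: to_ac_0)
    qed
    ultimately have "\<gamma> ` ?R = ?R"
      using inj by (meson endo_inj_surj inj_on_subset subset_UNIV)
    then show "\<exists>x. y = \<gamma> x" using q(2) by blast
  qed
  then have "\<gamma> \<in> GalK"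
    using inj add mult fix_K by (auto simp: Gal_def bij_def)
  then show ?thesis using eq GM by blast
qed

text \<open>The minimal polynomial of an \<open>x\<close> outside K has degree at least two, and in
  characteristic zero its roots are simple. So there is another root \<open>y\<close>, and sending
  \<open>x\<close> to \<open>y\<close> extends to an automorphism that moves
  \<open>x\<close>.\<close>

theorem GalK_fixed_field:
  fixes x :: "'k::field_char_0 alg_closure"
  assumes fixed: "\<And>\<gamma>. \<gamma> \<in> GalK \<Longrightarrow> \<gamma> x = x"
  shows "x \<in> range to_ac"
proof (rule ccontr)
  assume x: "x \<notin> range to_ac"
  \<comment> \<open>The graph of the identity on K: \<open>poly_rel G f g\<close> now says that
    \<open>f = g\<close> has coefficients in K.\<close>
  define G where "G = {(to_ac k, to_ac k) | k :: 'k. True}"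
  have G: "partial_hom G"
    unfolding partial_hom_def G_def by (auto, (metis to_ac_add to_ac_mult)+)
  have relI: "poly_rel G f f" if "\<And>n. Polynomial.coeff f n \<in> range to_ac" for f
    using that by (auto simp: poly_rel_def G_def image_iff)
  have relD: "f = g \<and> Polynomial.coeff f n \<in> range to_ac" if "poly_rel G f g" for f g n
  proof -
    have "\<exists>k. Polynomial.coeff f n = to_ac k \<and> Polynomial.coeff g n = to_ac k" for n
      using that by (auto simp: poly_rel_def G_def)
    then show ?thesis by (metis poly_eq_iff rangeI)
  qed
  obtain p p' where p: "poly_rel G p p'" "p \<noteq> 0" "poly p x = 0"
    and min: "\<And>f g. poly_rel G f g \<Longrightarrow> f \<noteq> 0 \<Longrightarrow> poly f x = 0 \<Longrightarrow> Polynomial.degree p \<le> Polynomial.degree f"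
    using exists_minimal_poly_rel[OF G, of x] by blast
  have pp': "p' = p" using relD[OF p(1)] by simp
  have pK: "Polynomial.coeff p n \<in> range to_ac" for n using relD[OF p(1)] by blast
  obtain s where s: "p = [:- x, 1:] * s"
    using p(3) by (auto simp: poly_eq_0_iff_dvd elim: dvdE)
  have "s \<noteq> 0" using s p(2) by auto
  have "Polynomial.degree s > 0"
  proof (rule ccontr)
    assume "\<not> Polynomial.degree s > 0"
    then obtain e where e: "s = [:e:]" by (metis degree_eq_zeroE gr0I)
    then have "e \<noteq> 0" using \<open>s \<noteq> 0\<close> by simp
    obtain k where k: "- (x * e) = to_ac k"
      using pK[of 0] by (auto simp: s e mult.commute[of x e])
    obtain l where l: "e = to_ac l"
      using pK[of 1] by (auto simp: s e)
    have "x * e = - to_ac k"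
      using k by (metis minus_minus)
    then have "x = to_ac (- k / l)"
      using \<open>e \<noteq> 0\<close> l by (metis eq_divide_eq to_ac_divide to_ac_minus)
    then show False using x by blast
  qed
  then obtain y where y: "poly s y = 0"
    using alg_closed_imp_poly_has_root by blast
  have deg: "Polynomial.degree p = Suc (Polynomial.degree s)"
    unfolding s using \<open>s \<noteq> 0\<close> by (subst degree_mult_eq) auto
  have "y \<noteq> x"
  proof
    assume "y = x"
    \<comment> \<open>A double root would also be a root of the derivative, which is nonzero in
      characteristic zero and of smaller degree, against minimality of \<open>p\<close>.\<close>
    have "pderiv p = [:- x, 1:] * pderiv s + s * [:1:]"
      by (simp only: s pderiv_mult) (simp add: pderiv_pCons)
    then have "poly (pderiv p) x = 0"
      using y \<open>y = x\<close> by simp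
    moreover have "pderiv p \<noteq> 0" using deg by (simp add: pderiv_eq_0_iff)
    moreover have "Polynomial.coeff (pderiv p) n \<in> range to_ac" for n
    proof -
      obtain k where "Polynomial.coeff p (Suc n) = to_ac k" using pK by blast
      then have "Polynomial.coeff (pderiv p) n = to_ac (of_nat (Suc n) * k)"
        by (simp only: coeff_pderiv to_ac_mult to_ac_of_nat)
      then show ?thesis by blast
    qed
    ultimately have "Polynomial.degree p \<le> Polynomial.degree (pderiv p)"
      using min relI by blast
    then show False using deg by (simp add: degree_pderiv)
  qed
  have "poly p y = 0" using y by (simp add: s)
  then obtain G' where "partial_hom G'" "(x, y) \<in> G'"
    using partial_hom_extend_root[OF G p, where w = y] min pp' by blast
  then show False
    using partial_hom_extend_automorphism[of G'] fixed \<open>y \<noteq> x\<close> by force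
qed

section \<open>Transport and scalar extension of Lie bialgebras\<close>

lemma ad2_hom:
  assumes "lin \<phi>" "lie_algebra B1" "lie_algebra B2" "\<And>x y. \<phi> (B1 x y) = B2 (\<phi> x) (\<phi> y)"
  shows "tens_map \<phi> \<phi> (ad2 B1 a t) = ad2 B2 (\<phi> a) (tens_map \<phi> \<phi> t)"
  by (induction t rule: tens_induct) (simp_all add: assms tens_map_add ad2_tens ad2_add)

lemma lie_bialgebra_transport:
  assumes B2: "lie_bialgebra B2 \<delta>2" and B1: "lie_algebra B1" and iso: "lie_iso B1 B2 \<phi>"
    and \<delta>1: "lin \<delta>1" and \<delta>: "\<And>x. tens_map \<phi> \<phi> (\<delta>1 x) = \<delta>2 (\<phi> x)"
  shows "lie_bialgebra B1 \<delta>1"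
proof -
  have \<phi>: "lin \<phi>" and bij: "bij \<phi>" and hom: "\<And>x y. \<phi> (B1 x y) = B2 (\<phi> x) (\<phi> y)"
    using iso by (auto simp: lie_iso_def)
  have lie2: "lie_algebra B2" and \<delta>2: "lin \<delta>2"
    and skew: "\<And>x. flip (\<delta>2 x) = - \<delta>2 x"
    and cojac: "\<And>x t. t = tens_map id \<delta>2 (\<delta>2 x) \<Longrightarrow> t + cyc t + cyc (cyc t) = 0"
    and cocycle: "\<And>a b. \<delta>2 (B2 a b) = ad2 B2 a (\<delta>2 b) - ad2 B2 b (\<delta>2 a)"
    using B2 by (auto simp: lie_bialgebra_def Let_def)
  obtain \<psi> where \<psi>: "lin \<psi>" "\<psi> \<circ> \<phi> = id"
    using vec.linear_injective_left_inverse[OF \<phi>] bij by (auto simp: bij_def)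
  have \<psi>\<phi>: "\<psi> (\<phi> x) = x" for x
    using \<psi>(2) by (metis comp_apply id_apply)
  let ?\<phi>2 = "tens_map \<phi> \<phi>" and ?\<psi>2 = "tens_map \<psi> \<psi>"
  have inv2: "?\<psi>2 (?\<phi>2 t) = t" for t
    by (simp add: tens_map_compose \<phi> \<psi> \<psi>\<phi>)
  have inv3: "tens_map \<psi> ?\<psi>2 (tens_map \<phi> ?\<phi>2 t) = t" for t
    by (simp add: tens_map_compose \<phi> \<psi> \<psi>\<phi> tens_map_lin inv2)
  have inj2: "s = t" if "?\<phi>2 s = ?\<phi>2 t" for s t
    using that inv2 by metis
  have "flip (\<delta>1 x) = - \<delta>1 x" for x
    by (rule inj2) (simp add: flip_tens_map[OF \<phi> \<phi>, symmetric] \<delta> skew lin_neg[OF tens_map_lin])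
  moreover have "t + cyc t + cyc (cyc t) = 0" if t: "t = tens_map id \<delta>1 (\<delta>1 x)" for x t
  proof -
    have "tens_map \<phi> ?\<phi>2 (tens_map id \<delta>1 s) = tens_map id \<delta>2 (?\<phi>2 s)" for s
      by (induction s rule: tens_induct)
        (simp_all add: tens_map_add tens_map_lin \<phi> \<delta>1 \<delta>2 \<delta>)
    then have t': "tens_map \<phi> ?\<phi>2 t = tens_map id \<delta>2 (\<delta>2 (\<phi> x))"
      by (simp add: t \<delta>)
    have "tens_map \<phi> ?\<phi>2 (t + cyc t + cyc (cyc t)) = 0"
      using cojac[OF t'] by (simp add: tens_map_add cyc_tens_map[OF \<phi>, symmetric])
    then show ?thesis
      using inv3[of "t + cyc t + cyc (cyc t)"] by (simp add: tens_map_zero)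
  qed
  moreover have "\<delta>1 (B1 a b) = ad2 B1 a (\<delta>1 b) - ad2 B1 b (\<delta>1 a)" for a b
  proof (rule inj2)
    have ad: "?\<phi>2 (ad2 B1 a t) = ad2 B2 (\<phi> a) (?\<phi>2 t)" for a t
      by (rule ad2_hom) (fact \<phi> B1 lie2 hom)+
    show "?\<phi>2 (\<delta>1 (B1 a b)) = ?\<phi>2 (ad2 B1 a (\<delta>1 b) - ad2 B1 b (\<delta>1 a))"
      by (simp only: tens_map_diff ad \<delta> hom cocycle)
  qed
  ultimately show ?thesis
    using B1 \<delta>1 unfolding lie_bialgebra_def Let_def by blast
qed

lemma ext_vec_ad2:
  assumes h: "field_hom h" and lie: "lie_algebra B"
  shows "ext_vec h (ad2 B a t) = ad2 (ext_bracket h B) (ext_vec h a) (ext_vec h t)"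
proof -
  note lie' = ext_bracket_lie_algebra[OF h lie]
  show ?thesis
    by (induction t rule: tens_induct)
      (simp_all add: ad2_tens[OF lie] ad2_tens[OF lie'] ad2_add[OF lie] ad2_add[OF lie']
        ext_vec_add[OF h] ext_vec_tens[OF h] ext_bracket_lie_ext_vec[OF h lie])
qed

text \<open>The axioms are equations that \<open>ext_vec h\<close> respects, and it is
  injective.\<close>

lemma lie_bialgebra_restrict_scalars:
  assumes h: "field_hom h" and lie: "lie_algebra B" and \<delta>: "lin \<delta>"
    and bi: "lie_bialgebra (ext_bracket h B) (ext_lin h \<delta>)"
  shows "lie_bialgebra B \<delta>"
proof -
  have skew: "\<And>x. flip (ext_lin h \<delta> x) = - ext_lin h \<delta> x"
    and cojac: "\<And>x t. t = tens_map id (ext_lin h \<delta>) (ext_lin h \<delta> x) \<Longrightarrow> t + cyc t + cyc (cyc t) = 0"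
    and cocycle: "\<And>a b. ext_lin h \<delta> (ext_bracket h B a b)
        = ad2 (ext_bracket h B) a (ext_lin h \<delta> b) - ad2 (ext_bracket h B) b (ext_lin h \<delta> a)"
    using bi by (auto simp: lie_bialgebra_def Let_def)
  note ext = ext_vec_eq[OF h, THEN iffD1]
  note ext_\<delta> = ext_lin_ext_vec[OF h \<delta>]
  have "flip (\<delta> x) = - \<delta> x" for x
    by (rule ext) (simp add: ext_vec_flip[OF h] ext_vec_neg[OF h] skew flip: ext_\<delta>)
  moreover have "t + cyc t + cyc (cyc t) = 0" if t: "t = tens_map id \<delta> (\<delta> x)" for x t
  proof (rule ext)
    have "ext_vec h t = tens_map id (ext_lin h \<delta>) (ext_lin h \<delta> (ext_vec h x))"
      by (simp add: t ext_vec_tens_map[OF h] \<delta> ext_lin_id[OF h] ext_\<delta>)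
    from cojac[OF this] show "ext_vec h (t + cyc t + cyc (cyc t)) = ext_vec h 0"
      by (simp add: ext_vec_add[OF h] ext_vec_cyc[OF h] ext_vec_zero[OF h])
  qed
  moreover have "\<delta> (B a b) = ad2 B a (\<delta> b) - ad2 B b (\<delta> a)" for a b
    by (rule ext) (simp add: ext_vec_diff[OF h] ext_vec_ad2[OF h lie] cocycle
        flip: ext_\<delta> ext_bracket_lie_ext_vec[OF h lie])
  ultimately show ?thesis
    using lie \<delta> unfolding lie_bialgebra_def Let_def by blast
qed

lemma CYB_ext:
  assumes h: "field_hom h" and lie: "lie_algebra B"
  shows "CYB (ext_bracket h B) (ext_vec h r) = ext_vec h (CYB B r)"
  unfolding CYB_def Let_def
  by (simp add: split_def ext_vec_sum[OF h] ext_vec_add[OF h] ext_vec_tens[OF h]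
      ext_vec_scale[OF h] ext_vec_axis[OF h] ext_vec_nth[OF h] flip: ext_bracket_lie_ext_vec[OF h lie])

lemma ext_lin_coboundary:
  assumes h: "field_hom h" and lie: "lie_algebra B"
  shows "ext_lin h (coboundary B r) x = ad2 (ext_bracket h B) x (ext_vec h r)"
  by (rule lin_eqI[OF ext_lin_lin[OF h] ad2_lin_left[OF ext_bracket_lie_algebra[OF h lie]]])
    (simp add: ext_lin_axis[OF h] coboundary_def ext_vec_ad2[OF h lie] ext_vec_axis[OF h])

section \<open>The absolute Galois group\<close>

lemma field_hom_to_ac: "field_hom to_ac"
  by (simp add: field_hom_def)

lemma field_hom_of_rat: "field_hom (of_rat :: rat \<Rightarrow> 'a::field_char_0)"
  by (simp add: field_hom_def of_rat_add of_rat_mult)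

lemma ring_of_type_algebra_a_inv: "\<ominus>\<^bsub>ring_of_type_algebra\<^esub> x = - (x :: 'a::field)"
proof -
  interpret R: field "ring_of_type_algebra :: 'a ring" by (rule field_from_type_algebra)
  show ?thesis by (rule R.minus_equality) (simp_all add: ring_of_type_algebra_def)
qed

lemma ring_of_type_algebra_m_inv:
  assumes "x \<noteq> 0"
  shows "inv\<^bsub>ring_of_type_algebra\<^esub> x = inverse (x :: 'a::field)"
proof -
  interpret R: field "ring_of_type_algebra :: 'a ring" by (rule field_from_type_algebra)
  show ?thesis
    by (rule R.inv_unique'[symmetric]) (simp_all add: ring_of_type_algebra_def assms)
qed

context
  fixes \<gamma> :: "'k::field alg_closure \<Rightarrow> 'k alg_closure"
  assumes \<gamma>: "\<gamma> \<in> GalK"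
begin

lemma Gal_field_hom: "field_hom \<gamma>"
proof -
  have "\<gamma> 1 = 1" using \<gamma> by (auto simp: Gal_def simp flip: to_ac_1)
  then show ?thesis using \<gamma> by (auto simp: Gal_def field_hom_def)
qed

lemma Gal_to_ac: "\<gamma> (to_ac k) = to_ac k"
  using \<gamma> by (auto simp: Gal_def)

lemma Gal_surj_ext_vec: "\<exists>y. x = ext_vec \<gamma> y"
proof -
  have "surj \<gamma>" using \<gamma> by (auto simp: Gal_def bij_def)
  then have "x = ext_vec \<gamma> (\<chi> i. inv_into UNIV \<gamma> (x $ i))"
    by (simp add: ext_vec_def vec_eq_iff surj_f_inv_f)
  then show ?thesis by blast
qed

lemma Gal_ext_vec_to_ac: "ext_vec \<gamma> (ext_vec to_ac x) = ext_vec to_ac x"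
  by (simp add: ext_vec_def Gal_to_ac)

lemma Gal_ext_bracket:
  assumes lie: "lie_algebra B"
  shows "ext_vec \<gamma> (ext_bracket to_ac B x y) = ext_bracket to_ac B (ext_vec \<gamma> x) (ext_vec \<gamma> y)"
  using ext_bracket_lie_ext_vec[OF Gal_field_hom ext_bracket_lie_algebra[OF field_hom_to_ac lie], of x y]
    ext_bracket_ext_bracket[OF Gal_field_hom field_hom_to_ac, of B]
  by (simp add: Gal_to_ac)

lemma Gal_ext_lin: "ext_vec \<gamma> (ext_lin to_ac f x) = ext_lin to_ac f (ext_vec \<gamma> x)"
proof (induction x rule: vec_induct)
  case (axis c i)
  show ?case
    by (simp add: lin_scale[OF ext_lin_lin[OF field_hom_to_ac]] ext_vec_scale[OF Gal_field_hom]
        ext_vec_axis[OF Gal_field_hom] ext_lin_axis[OF field_hom_to_ac] Gal_ext_vec_to_ac)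
qed (simp add: ext_vec_add[OF Gal_field_hom] lin_add[OF ext_lin_lin[OF field_hom_to_ac]])

lemma Gal_K_adjoin: "\<gamma> \<in> Gal (K_adjoin \<alpha>) \<longleftrightarrow> \<gamma> \<alpha> = \<alpha>"
proof
  assume "\<gamma> \<in> Gal (K_adjoin \<alpha>)"
  then show "\<gamma> \<alpha> = \<alpha>"
    by (auto simp: Gal_def K_adjoin_def intro: generate_field.incl)
next
  assume \<alpha>: "\<gamma> \<alpha> = \<alpha>"
  have "\<gamma> x = x" if "x \<in> K_adjoin \<alpha>" for x
    using that unfolding K_adjoin_def
  proof (induction rule: generate_field.induct)
    case one
    then show ?case using field_hom_one[OF Gal_field_hom] by (simp add: ring_of_type_algebra_def)
  next
    case (incl z)
    then show ?case using \<alpha> Gal_to_ac by auto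
  next
    case (a_inv z)
    then show ?case by (simp add: ring_of_type_algebra_a_inv field_hom_neg[OF Gal_field_hom])
  next
    case (m_inv z)
    then have "z \<noteq> 0" by (simp add: ring_of_type_algebra_def)
    then show ?case
      using m_inv.IH
      by (simp add: ring_of_type_algebra_m_inv field_hom_inverse[OF Gal_field_hom])
  next
    case (eng_add x y)
    then show ?case by (simp add: ring_of_type_algebra_def field_hom_add[OF Gal_field_hom])
  next
    case (eng_mult x y)
    then show ?case by (simp add: ring_of_type_algebra_def field_hom_mult[OF Gal_field_hom])
  qed
  then show "\<gamma> \<in> Gal (K_adjoin \<alpha>)" using \<gamma> by (auto simp: Gal_def)
qed

end

text \<open>With K among its own finite extensions, all of Gal(K) is an open set of the Krull
  topology; thus continuity of a cocycle says something about each of its values, in particular that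
  they are automorphisms.\<close>

lemma finite_ext_base: "finite_ext (range (to_ac :: 'k::field \<Rightarrow> 'k alg_closure))"
proof -
  interpret R: field "ring_of_type_algebra :: 'k alg_closure ring" by (rule field_from_type_algebra)
  have "subfield (range (to_ac :: 'k \<Rightarrow> _)) ring_of_type_algebra"
  proof (rule R.subfieldI')
    show "subring (range (to_ac :: 'k \<Rightarrow> _)) ring_of_type_algebra"
      by (rule R.subringI)
        (auto simp: ring_of_type_algebra_a_inv,
         auto simp: ring_of_type_algebra_def image_iff
           simp flip: to_ac_1 to_ac_minus to_ac_add to_ac_mult)
    show "inv\<^bsub>ring_of_type_algebra\<^esub> x \<in> range to_ac"
      if "x \<in> range to_ac - {\<zero>\<^bsub>ring_of_type_algebra\<^esub>}" for x :: "'k alg_closure"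
    proof -
      have "x \<noteq> 0" "x \<in> range to_ac" using that by (auto simp: ring_of_type_algebra_def)
      then show ?thesis by (auto simp: ring_of_type_algebra_m_inv simp flip: to_ac_inverse)
    qed
  qed
  moreover have "range (to_ac :: 'k \<Rightarrow> _) = module.span (\<lambda>c x. to_ac c * x) {1}"
  proof -
    interpret V: vector_space "\<lambda>(c::'k) x. to_ac c * x"
      by unfold_locales (simp_all add: algebra_simps)
    show ?thesis unfolding V.span_singleton by simp
  qed
  ultimately show ?thesis
    unfolding finite_ext_def by (metis finite.emptyI finite.insertI)
qed

lemma GalK_topspace: "\<gamma> \<in> GalK \<Longrightarrow> \<gamma> \<in> topspace krull_topology"
proof -
  assume \<gamma>: "\<gamma> \<in> GalK"
  have "id \<in> GalK" by (simp add: Gal_def)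
  then have "\<gamma> \<in> {\<gamma> \<circ> \<tau> | \<tau>. \<tau> \<in> GalK}"
    by (intro CollectI exI[of _ id]) simp
  then show ?thesis
    unfolding krull_topology_def topology_generated_by_topspace
    using \<gamma> finite_ext_base by blast
qed

section \<open>Galois descent\<close>

locale galois_descent =
  fixes B :: "('k::field_char_0, 'n::finite) bracket"
    and u :: "('k alg_closure \<Rightarrow> 'k alg_closure) \<Rightarrow> 'k alg_closure^'n \<Rightarrow> 'k alg_closure^'n"
    and B' :: "('k, 'm::finite) bracket"
    and j :: "'k^'m \<Rightarrow> 'k alg_closure^'n"
  assumes lie: "lie_algebra B"
    and twisted: "twisted_form B B'"
    and u_aut: "\<gamma> \<in> GalK \<Longrightarrow> u \<gamma> \<in> lie_aut (ext_bracket to_ac B)"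
    and corr: "corresponds B u B' j"
begin

abbreviation "BL \<equiv> ext_bracket to_ac B"
abbreviation "BL' \<equiv> ext_bracket to_ac B'"
abbreviation "\<Phi> \<equiv> lin_lift j"
abbreviation "\<Phi>2 \<equiv> tens_map \<Phi> \<Phi>"

text \<open>The twisted semilinear action, whose fixed points form \<gg>'; \<open>tw2\<close> is the
  induced action on the tensor square.\<close>

definition "tw \<gamma> x = u \<gamma> (ext_vec \<gamma> x)"
definition "tw2 \<gamma> t = tens_map (u \<gamma>) (u \<gamma>) (ext_vec \<gamma> t)"

lemmas ac = field_hom_to_ac

lemma lie_BL: "lie_algebra BL"
  by (rule ext_bracket_lie_algebra[OF ac lie])

lemma lie_B': "lie_algebra B'"
  using twisted by (simp add: twisted_form_def)

lemma lie_BL': "lie_algebra BL'"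
  by (rule ext_bracket_lie_algebra[OF ac lie_B'])

lemma u_lin: "\<gamma> \<in> GalK \<Longrightarrow> lin (u \<gamma>)"
  and u_hom: "\<gamma> \<in> GalK \<Longrightarrow> u \<gamma> (BL x y) = BL (u \<gamma> x) (u \<gamma> y)"
  using u_aut by (auto simp: lie_aut_def lie_iso_def)

lemma j_add: "j (x + y) = j x + j y" and j_scale: "j (c *s x) = to_ac c *s j x"
  using corr by (simp_all add: corresponds_def Vector_Spaces.linear_iff)

lemma j_fixed: "\<gamma> \<in> GalK \<Longrightarrow> tw \<gamma> (j x) = j x"
  using corr by (auto simp: corresponds_def bij_betw_def twisted_fixed_points_def tw_def)

lemma j_inj: "j x = j y \<Longrightarrow> x = y"
  using corr by (auto simp: corresponds_def bij_betw_def inj_on_def)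

lemma \<Phi>_lin: "lin \<Phi>"
  by (rule lin_lift_lin[OF ac])

lemma \<Phi>_axis: "\<Phi> (axis i 1) = j (axis i 1)"
  by (rule lin_lift_axis[OF ac])

lemma \<Phi>_ext_vec: "\<Phi> (ext_vec to_ac x) = j x"
  by (rule lin_lift_ext_vec[OF ac j_add j_scale])

context
  fixes \<gamma> :: "'k alg_closure \<Rightarrow> 'k alg_closure" assumes \<gamma>: "\<gamma> \<in> GalK"
begin

lemma tw_add: "tw \<gamma> (x + y) = tw \<gamma> x + tw \<gamma> y"
  and tw_scale: "tw \<gamma> (c *s x) = \<gamma> c *s tw \<gamma> x"
  by (simp_all add: tw_def ext_vec_add[OF Gal_field_hom[OF \<gamma>]]
      ext_vec_scale[OF Gal_field_hom[OF \<gamma>]] lin_add[OF u_lin[OF \<gamma>]] lin_scale[OF u_lin[OF \<gamma>]])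

lemma tw2_add: "tw2 \<gamma> (s + t) = tw2 \<gamma> s + tw2 \<gamma> t"
  and tw2_scale: "tw2 \<gamma> (c *s t) = \<gamma> c *s tw2 \<gamma> t"
  and tw2_tens: "tw2 \<gamma> (tens x y) = tens (tw \<gamma> x) (tw \<gamma> y)"
  by (simp_all add: tw2_def tw_def ext_vec_add[OF Gal_field_hom[OF \<gamma>]] tens_map_add tens_map_scale
      ext_vec_scale[OF Gal_field_hom[OF \<gamma>]] ext_vec_tens[OF Gal_field_hom[OF \<gamma>]] u_lin[OF \<gamma>])

lemma tw_bracket: "tw \<gamma> (BL x y) = BL (tw \<gamma> x) (tw \<gamma> y)"
  by (simp add: tw_def Gal_ext_bracket[OF \<gamma> lie] u_hom[OF \<gamma>])

text \<open>Both sides are semilinear along \<gamma>, and they agree on the basis because the image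
  of \<open>j\<close> is fixed by the twisted action. In the coordinates of \<gg>' that action is
  therefore the plain one.\<close>

lemma tw_\<Phi>: "tw \<gamma> (\<Phi> x) = \<Phi> (ext_vec \<gamma> x)"
proof (induction x rule: vec_induct)
  case (axis c i)
  show ?case
    by (simp add: lin_scale[OF \<Phi>_lin] tw_scale \<Phi>_axis j_fixed[OF \<gamma>]
        ext_vec_scale[OF Gal_field_hom[OF \<gamma>]] ext_vec_axis[OF Gal_field_hom[OF \<gamma>]])
qed (simp add: lin_add[OF \<Phi>_lin] tw_add ext_vec_add[OF Gal_field_hom[OF \<gamma>]])

lemma tw2_\<Phi>2: "tw2 \<gamma> (\<Phi>2 t) = \<Phi>2 (ext_vec \<gamma> t)"
  by (induction t rule: tens_induct)
    (simp_all add: \<Phi>_lin tw2_tens tw_\<Phi> ext_vec_tens[OF Gal_field_hom[OF \<gamma>]] tens_map_add tw2_add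
      ext_vec_add[OF Gal_field_hom[OF \<gamma>]])

lemma tw2_ad2: "tw2 \<gamma> (ad2 BL x t) = ad2 BL (tw \<gamma> x) (tw2 \<gamma> t)"
  by (induction t rule: tens_induct)
    (simp_all add: ad2_tens[OF lie_BL] ad2_add[OF lie_BL] tw2_tens tw2_add tw_bracket)

end

lemma fixed_vec:
  fixes x :: "'k alg_closure^'p::finite"
  assumes "\<And>\<gamma>. \<gamma> \<in> GalK \<Longrightarrow> ext_vec \<gamma> x = x"
  shows "\<exists>y. x = ext_vec to_ac y"
proof -
  have "x $ i \<in> range to_ac" for i
  proof (rule GalK_fixed_field)
    fix \<gamma> :: "'k alg_closure \<Rightarrow> 'k alg_closure" assume "\<gamma> \<in> GalK"
    from assms[OF this] show "\<gamma> (x $ i) = x $ i"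
      by (simp add: ext_vec_def vec_eq_iff)
  qed
  then have "x = ext_vec to_ac (\<chi> i. of_ac (x $ i))"
    by (simp add: ext_vec_def vec_eq_iff to_ac_of_ac)
  then show ?thesis by blast
qed

text \<open>
  A nonzero vector of minimal support in the kernel, scaled so that some coordinate is \<open>1\<close>, is fixed
  by the Galois group, since otherwise subtracting a conjugate would decrease the support.
\<close>

lemma \<Phi>_kernel:
  assumes "\<Phi> x = 0"
  shows "x = 0"
proof (rule ccontr)
  assume "x \<noteq> 0"
  define supp where "supp y = {i. y $ i \<noteq> 0}" for y :: "'k alg_closure^'m"
  obtain y where y: "\<Phi> y = 0" "y \<noteq> 0"
    and min: "\<And>z. \<Phi> z = 0 \<Longrightarrow> z \<noteq> 0 \<Longrightarrow> card (supp y) \<le> card (supp z)"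
    using ex_has_least_nat[of "\<lambda>y. \<Phi> y = 0 \<and> y \<noteq> 0" x "\<lambda>y. card (supp y)"] assms \<open>x \<noteq> 0\<close> by blast
  obtain i where i: "y $ i \<noteq> 0" using y(2) by (auto simp: vec_eq_iff)
  define z where "z = inverse (y $ i) *s y"
  have z: "\<Phi> z = 0" "z $ i = 1"
    using y i by (simp_all add: z_def lin_scale[OF \<Phi>_lin])
  have supp_z: "supp z = supp y" using i by (auto simp: supp_def z_def)
  have "ext_vec \<gamma> z = z" if \<gamma>: "\<gamma> \<in> GalK" for \<gamma>
  proof (rule ccontr)
    note hom = Gal_field_hom[OF \<gamma>]
    assume "ext_vec \<gamma> z \<noteq> z"
    then have nz: "z - ext_vec \<gamma> z \<noteq> 0" by simp
    have "tw \<gamma> 0 = 0" using tw_add[OF \<gamma>, of 0 0] by simp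
    then have "\<Phi> (ext_vec \<gamma> z) = 0"
      using tw_\<Phi>[OF \<gamma>, of z] z(1) by simp
    then have "\<Phi> (z - ext_vec \<gamma> z) = 0" using z(1) by (simp add: lin_diff[OF \<Phi>_lin])
    moreover have sub: "supp (z - ext_vec \<gamma> z) \<subset> supp z"
    proof
      show "supp (z - ext_vec \<gamma> z) \<subseteq> supp z"
        by (auto simp: supp_def ext_vec_nth[OF hom] field_hom_zero[OF hom])
      have "i \<notin> supp (z - ext_vec \<gamma> z)" "i \<in> supp z"
        using z(2) by (simp_all add: supp_def ext_vec_nth[OF hom] field_hom_one[OF hom])
      then show "supp (z - ext_vec \<gamma> z) \<noteq> supp z" by blast
    qed
    moreover have "card (supp (z - ext_vec \<gamma> z)) < card (supp z)"
      by (rule psubset_card_mono[OF _ sub]) simp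
    ultimately show False
      using min[OF _ nz] by (simp add: supp_z)
  qed
  then obtain v where v: "z = ext_vec to_ac v" using fixed_vec by blast
  have "j v = j 0"
    using z(1) j_add[of 0 0] by (simp add: v \<Phi>_ext_vec)
  then have "v = 0" by (rule j_inj)
  then show False using z(2) by (simp add: v ext_vec_zero[OF ac])
qed

lemma \<Phi>_inj: "inj \<Phi>"
proof (rule injI)
  fix x y assume "\<Phi> x = \<Phi> y"
  then have "\<Phi> (x - y) = 0" by (simp add: lin_diff[OF \<Phi>_lin])
  then show "x = y" using \<Phi>_kernel[of "x - y"] by simp
qed

text \<open>Surjectivity needs equal dimensions, which the isomorphism of the twisted form provides:
  composing with its inverse \<theta> turns \<Phi> into an injective endomorphism.\<close>

lemma \<Phi>_bij: "bij \<Phi>"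
proof -
  obtain \<phi> where \<phi>: "lin (\<phi> :: 'k alg_closure^'m \<Rightarrow> 'k alg_closure^'n)" "bij \<phi>"
    using twisted by (auto simp: twisted_form_def lie_iso_def)
  obtain \<theta> where \<theta>: "lin \<theta>" "\<theta> \<circ> \<phi> = id"
    using vec.linear_injective_left_inverse[OF \<phi>(1)] \<phi>(2) by (auto simp: bij_def)
  have "\<phi> (\<theta> y) = y" for y
    using \<theta>(2) \<phi>(2) by (metis bij_pointE comp_apply id_apply)
  then have \<theta>_inj: "inj \<theta>" by (rule inj_on_inverseI)
  have "surj (\<lambda>x. \<theta> (\<Phi> x))"
    using vec.linear_injective_imp_surjective[OF lin_compose[OF \<theta>(1) \<Phi>_lin]] \<theta>_inj \<Phi>_inj
    by (simp add: inj_def)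
  then have "surj \<Phi>"
    using \<theta>_inj unfolding surj_def inj_def by blast
  then show ?thesis using \<Phi>_inj by (simp add: bij_def)
qed

lemma \<Phi>_iso: "lie_iso BL' BL \<Phi>"
proof -
  have "\<Phi> (BL' x y) = BL (\<Phi> x) (\<Phi> y)" for x y
  proof (induction x rule: vec_induct)
    case (axis c i)
    have "\<Phi> (BL' (axis i 1) y) = BL (\<Phi> (axis i 1)) (\<Phi> y)"
    proof (induction y rule: vec_induct)
      case (axis d k)
      have "\<Phi> (BL' (axis i 1) (axis k 1)) = BL (j (axis i 1)) (j (axis k 1))"
        using corr by (simp add: ext_bracket_axis[OF ac] \<Phi>_ext_vec corresponds_def)
      then show ?case
        by (simp add: lie_scale_right[OF lie_BL'] lie_scale_right[OF lie_BL] lin_scale[OF \<Phi>_lin] \<Phi>_axis)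
    qed (simp add: lie_add_right[OF lie_BL'] lie_add_right[OF lie_BL] lin_add[OF \<Phi>_lin])
    then show ?case
      by (simp add: lie_scale_left[OF lie_BL'] lie_scale_left[OF lie_BL] lin_scale[OF \<Phi>_lin])
  qed (simp add: lie_add_left[OF lie_BL'] lie_add_left[OF lie_BL] lin_add[OF \<Phi>_lin])
  then show ?thesis using \<Phi>_lin \<Phi>_bij by (simp add: lie_iso_def)
qed

section \<open>Descent as equivariance\<close>

lemma descends_imp_equivariant:
  assumes "descends B' j BL \<delta>" and \<gamma>: "\<gamma> \<in> GalK"
  shows "tw2 \<gamma> (\<delta> x) = \<delta> (tw \<gamma> x)"
proof -
  obtain \<delta>' where \<delta>': "\<And>x. \<Phi>2 (ext_lin to_ac \<delta>' x) = \<delta> (\<Phi> x)"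
    using assms(1) by (auto simp: descends_def lie_bialgebra_iso_def)
  obtain y where x: "x = \<Phi> y" using \<Phi>_bij by (metis bij_pointE)
  show ?thesis
    unfolding x tw_\<Phi>[OF \<gamma>] \<delta>'[symmetric] tw2_\<Phi>2[OF \<gamma>] Gal_ext_lin[OF \<gamma>] ..
qed

text \<open>Carried over to the coordinates of \<gg>' by \<Phi>, an equivariant cobracket commutes
  with the plain Galois action, so its values on K-rational vectors are fixed and hence
  K-rational.\<close>

lemma equivariant_imp_descends:
  assumes \<delta>: "lie_bialgebra BL \<delta>"
    and equi: "\<And>\<gamma> x. \<gamma> \<in> GalK \<Longrightarrow> tw2 \<gamma> (\<delta> x) = \<delta> (tw \<gamma> x)"
  shows "descends B' j BL \<delta>"
proof -
  have \<delta>_lin: "lin \<delta>" using \<delta> by (simp add: lie_bialgebra_def)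
  obtain \<Psi> where \<Psi>: "lin \<Psi>" "\<Psi> \<circ> \<Phi> = id"
    using vec.linear_injective_left_inverse[OF \<Phi>_lin \<Phi>_inj] by blast
  have \<Psi>\<Phi>: "\<Psi> (\<Phi> x) = x" for x using \<Psi>(2) by (metis comp_apply id_apply)
  have \<Phi>\<Psi>: "\<Phi> (\<Psi> y) = y" for y
    using \<Psi>\<Phi> \<Phi>_bij by (metis bij_pointE)
  have \<Phi>2_inj: "s = t" if "\<Phi>2 s = \<Phi>2 t" for s t
  proof -
    have "tens_map \<Psi> \<Psi> (\<Phi>2 t) = t" for t
      by (simp add: tens_map_compose \<Psi> \<Phi>_lin \<Psi>\<Phi>)
    then show ?thesis using that by metis
  qed
  define D where "D x = tens_map \<Psi> \<Psi> (\<delta> (\<Phi> x))" for x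
  have D_lin: "lin D"
    unfolding D_def by (intro lin_compose[OF tens_map_lin] lin_compose[OF \<delta>_lin] \<Phi>_lin)
  have \<Phi>2_D: "\<Phi>2 (D x) = \<delta> (\<Phi> x)" for x
    by (simp add: D_def tens_map_compose \<Psi> \<Phi>_lin \<Phi>\<Psi>)
  have D_equi: "ext_vec \<gamma> (D x) = D (ext_vec \<gamma> x)" if \<gamma>: "\<gamma> \<in> GalK" for \<gamma> x
    by (rule \<Phi>2_inj)
      (simp only: tw2_\<Phi>2[OF \<gamma>, symmetric] \<Phi>2_D equi[OF \<gamma>] tw_\<Phi>[OF \<gamma>])
  have "\<exists>t. D (ext_vec to_ac y) = ext_vec to_ac t" for y
    by (rule fixed_vec) (simp add: D_equi Gal_ext_vec_to_ac)
  then obtain \<delta>' where \<delta>': "D (ext_vec to_ac y) = ext_vec to_ac (\<delta>' y)" for y by metis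
  have \<delta>'_lin: "lin \<delta>'"
  proof (rule linI)
    show "\<delta>' (x + y) = \<delta>' x + \<delta>' y" for x y
      by (rule ext_vec_eq[OF ac, THEN iffD1])
        (simp add: ext_vec_add[OF ac] lin_add[OF D_lin] flip: \<delta>')
    show "\<delta>' (c *s x) = c *s \<delta>' x" for c x
      by (rule ext_vec_eq[OF ac, THEN iffD1])
        (simp add: ext_vec_scale[OF ac] lin_scale[OF D_lin] flip: \<delta>')
  qed
  have ext_\<delta>': "ext_lin to_ac \<delta>' x = D x" for x
    by (rule lin_eqI[OF ext_lin_lin[OF ac] D_lin])
      (simp add: ext_lin_axis[OF ac] ext_vec_axis[OF ac] flip: \<delta>')
  have "lie_bialgebra BL' D"
    by (rule lie_bialgebra_transport[OF \<delta> lie_BL' \<Phi>_iso D_lin \<Phi>2_D])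
  then have "lie_bialgebra BL' (ext_lin to_ac \<delta>')"
    using ext_\<delta>' by (simp add: ext[of "ext_lin to_ac \<delta>'" D])
  then have "lie_bialgebra B' \<delta>'"
    by (rule lie_bialgebra_restrict_scalars[OF ac lie_B' \<delta>'_lin])
  then show ?thesis
    unfolding descends_def lie_bialgebra_iso_def using \<Phi>_iso ext_\<delta>' \<Phi>2_D by auto
qed

text \<open>The twisted action respects \<open>ad2\<close>, so for a coboundary the equivariance
  condition only compares \<open>r\<close> with its image under \<open>u \<gamma>\<close>.\<close>

lemma descends_iff:
  assumes bi: "lie_bialgebra BL (\<lambda>x. \<alpha> *s ad2 BL x (ext_vec to_ac r))"
  shows "descends B' j BL (\<lambda>x. \<alpha> *s ad2 BL x (ext_vec to_ac r)) \<longleftrightarrow>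
    (\<forall>\<gamma>\<in>GalK. \<forall>x. \<gamma> \<alpha> *s ad2 BL x (tens_map (u \<gamma>) (u \<gamma>) (ext_vec to_ac r))
      = \<alpha> *s ad2 BL x (ext_vec to_ac r))"
proof -
  have eq: "tw2 \<gamma> (\<alpha> *s ad2 BL x (ext_vec to_ac r))
      = \<gamma> \<alpha> *s ad2 BL (tw \<gamma> x) (tens_map (u \<gamma>) (u \<gamma>) (ext_vec to_ac r))" if \<gamma>: "\<gamma> \<in> GalK" for \<gamma> x
    by (simp add: tw2_scale[OF \<gamma>] tw2_ad2[OF \<gamma>]) (simp add: tw2_def Gal_ext_vec_to_ac[OF \<gamma>])
  \<comment> \<open>Lets \<open>tw \<gamma> x\<close> be replaced by an arbitrary vector, so that
    both sides of the equivariance condition act with the same element.\<close>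
  have tw_surj: "\<exists>y. x = tw \<gamma> y" if \<gamma>: "\<gamma> \<in> GalK" for \<gamma> x
  proof -
    obtain y where "x = \<Phi> y" using \<Phi>_bij by (metis bij_pointE)
    moreover obtain z where "y = ext_vec \<gamma> z" using Gal_surj_ext_vec[OF \<gamma>] by blast
    ultimately show ?thesis using tw_\<Phi>[OF \<gamma>, of z] by metis
  qed
  have "descends B' j BL (\<lambda>x. \<alpha> *s ad2 BL x (ext_vec to_ac r)) \<longleftrightarrow>
    (\<forall>\<gamma>\<in>GalK. \<forall>x. tw2 \<gamma> (\<alpha> *s ad2 BL x (ext_vec to_ac r))
      = \<alpha> *s ad2 BL (tw \<gamma> x) (ext_vec to_ac r))"
    using descends_imp_equivariant equivariant_imp_descends[OF bi] by blast
  also have "\<dots> \<longleftrightarrow> (\<forall>\<gamma>\<in>GalK. \<forall>x. \<gamma> \<alpha> *s ad2 BL x (tens_map (u \<gamma>) (u \<gamma>) (ext_vec to_ac r))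
      = \<alpha> *s ad2 BL x (ext_vec to_ac r))"
    using eq tw_surj by metis
  finally show ?thesis .
qed

end

text \<open>With \<open>P\<close> and \<open>Q\<close> saying that \<open>u\<^sub>\<gamma>\<close> maps \<open>r\<close> to \<open>r\<close>, respectively to \<open>\<kappa>(r)\<close>, this is the case
  distinction between the two conditions of the theorem.\<close>

lemma sign_character_iff:
  fixes \<alpha> :: "'k::field_char_0 alg_closure" and P Q :: "('k alg_closure \<Rightarrow> 'k alg_closure) \<Rightarrow> bool"
  defines "Kx \<equiv> to_ac ` (UNIV - {0 :: 'k})"
  assumes "\<alpha> \<noteq> 0"
  shows "(\<forall>\<gamma>\<in>GalK. (\<gamma> \<alpha> = \<alpha> \<and> P \<gamma>) \<or> (\<gamma> \<alpha> = - \<alpha> \<and> Q \<gamma>)) \<longleftrightarrow>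
    (\<alpha> \<in> Kx \<and> (\<forall>\<gamma>\<in>GalK. P \<gamma>)) \<or>
    (\<alpha>\<^sup>2 \<in> Kx - (\<lambda>x. x\<^sup>2) ` Kx \<and>
      (\<forall>\<gamma>\<in>GalK. (\<gamma> \<in> Gal (K_adjoin \<alpha>) \<longrightarrow> P \<gamma>) \<and> (\<gamma> \<alpha> = - \<alpha> \<longrightarrow> Q \<gamma>)))"
    (is "?L \<longleftrightarrow> ?R1 \<or> ?R2")
proof -
  have neg: "\<alpha> \<noteq> - \<alpha>"
  proof
    assume "\<alpha> = - \<alpha>"
    then have "2 * \<alpha> = 0" by (simp only: eq_neg_iff_add_eq_0 mult_2)
    then show False using \<open>\<alpha> \<noteq> 0\<close> by simp
  qed
  have Kx_iff: "x \<in> Kx \<longleftrightarrow> x \<in> range to_ac \<and> x \<noteq> 0" for x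
    by (auto simp: Kx_def)
  \<comment> \<open>Square roots are unique up to sign, so \<alpha>^2 is a square of K exactly when
    \<alpha> itself lies in K; this separates the two conditions.\<close>
  have sq: "\<alpha>\<^sup>2 \<in> (\<lambda>x. x\<^sup>2) ` Kx \<longleftrightarrow> \<alpha> \<in> Kx"
  proof
    assume "\<alpha>\<^sup>2 \<in> (\<lambda>x. x\<^sup>2) ` Kx"
    then obtain k where "k \<noteq> 0" "\<alpha>\<^sup>2 = (to_ac k)\<^sup>2" by (auto simp: Kx_def)
    then have "\<alpha> = to_ac k \<or> \<alpha> = to_ac (- k)" by (simp add: power2_eq_iff)
    then show "\<alpha> \<in> Kx"
      using \<open>\<alpha> \<noteq> 0\<close> rangeI[of to_ac k] rangeI[of to_ac "- k"] by (auto simp: Kx_iff)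
  qed blast
  show ?thesis
  proof (cases "\<alpha> \<in> Kx")
    case True
    then have fixed: "\<gamma> \<alpha> = \<alpha>" if "\<gamma> \<in> GalK" for \<gamma>
      using Gal_to_ac[OF that] by (auto simp: Kx_def)
    have "\<gamma> \<alpha> \<noteq> - \<alpha>" if "\<gamma> \<in> GalK" for \<gamma>
      unfolding fixed[OF that] by (rule neg)
    then show ?thesis using True fixed sq by blast
  next
    case False
    then have \<alpha>: "\<alpha> \<notin> range to_ac" using \<open>\<alpha> \<noteq> 0\<close> by (simp add: Kx_iff)
    have "?L \<longleftrightarrow> ?R2"
    proof
      assume L: ?L
      have "\<alpha>\<^sup>2 \<in> range to_ac"
      proof (rule GalK_fixed_field)
        fix \<gamma> :: "'k alg_closure \<Rightarrow> 'k alg_closure" assume \<gamma>: "\<gamma> \<in> GalK"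
        then have "\<gamma> \<alpha> = \<alpha> \<or> \<gamma> \<alpha> = - \<alpha>" using L by blast
        then show "\<gamma> (\<alpha>\<^sup>2) = \<alpha>\<^sup>2"
          by (auto simp: field_hom_power[OF Gal_field_hom[OF \<gamma>]])
      qed
      moreover have "P \<gamma>" if "\<gamma> \<in> GalK" "\<gamma> \<in> Gal (K_adjoin \<alpha>)" for \<gamma>
        using L that Gal_K_adjoin[OF that(1)] neg by metis
      moreover have "Q \<gamma>" if "\<gamma> \<in> GalK" "\<gamma> \<alpha> = - \<alpha>" for \<gamma>
        using L that neg by metis
      ultimately show ?R2 using False sq \<open>\<alpha> \<noteq> 0\<close> by (auto simp: Kx_iff)
    next
      assume R: ?R2
      then obtain k where k: "\<alpha>\<^sup>2 = to_ac k" by (auto simp: Kx_iff)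
      have "\<gamma> \<alpha> = \<alpha> \<or> \<gamma> \<alpha> = - \<alpha>" if "\<gamma> \<in> GalK" for \<gamma>
      proof -
        have "(\<gamma> \<alpha>)\<^sup>2 = \<alpha>\<^sup>2"
          using field_hom_power[OF Gal_field_hom[OF that], of \<alpha> 2] Gal_to_ac[OF that, of k] k by simp
        then show ?thesis by (simp add: power2_eq_iff)
      qed
      then show ?L using R Gal_K_adjoin by blast
    qed
    then show ?thesis using False by blast
  qed
qed

theorem proposition5p2:
  fixes B0 :: "(rat, 'n::finite) bracket"
    and B :: "('k::field_char_0, 'n) bracket"
    and \<Omega> r :: "'k^('n \<times> 'n)"
    and \<delta> :: "('k, 'n) cobracket"
    and c :: 'k
    and \<alpha> :: "'k alg_closure"
    and u :: "('k alg_closure \<Rightarrow> 'k alg_closure) \<Rightarrow> 'k alg_closure^'n \<Rightarrow> 'k alg_closure^'n"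
    and B' :: "('k, 'm::finite) bracket"
    and j :: "'k^'m \<Rightarrow> 'k alg_closure^'n"
  defines "B \<equiv> ext_bracket of_rat B0"
    and "\<Omega> \<equiv> ext_vec of_rat (casimir B0)"
    and "\<delta> \<equiv> coboundary B r"
  assumes "split_simple B0"
    and "r_matrix B \<Omega> r"
    and "r + flip r = c *s \<Omega>" and "c \<noteq> 0"
    and "\<alpha> \<noteq> 0"
    and "twisted_form B B'"
    and "gal_cocycle B u"
    and "corresponds B u B' j"
  defines "rbar \<equiv> ext_vec to_ac r"
    and "Kx \<equiv> to_ac ` (UNIV - {0 :: 'k})"
  defines "cond1 \<equiv> \<alpha> \<in> Kx \<and> (\<forall>\<gamma>\<in>GalK. tens_map (u \<gamma>) (u \<gamma>) rbar = rbar)"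
    and "cond2 \<equiv> \<alpha>\<^sup>2 \<in> Kx - (\<lambda>x. x\<^sup>2) ` Kx \<and>
           (\<forall>\<gamma>\<in>GalK. (\<gamma> \<in> Gal (K_adjoin \<alpha>) \<longrightarrow> tens_map (u \<gamma>) (u \<gamma>) rbar = rbar) \<and>
                      (\<gamma> \<alpha> = - \<alpha> \<longrightarrow> tens_map (u \<gamma>) (u \<gamma>) rbar = flip rbar))"
  shows "(descends B' j (ext_bracket to_ac B) (\<lambda>x. \<alpha> *s ext_lin to_ac \<delta> x) \<longleftrightarrow> cond1 \<or> cond2)
    \<and> \<not> (cond1 \<and> cond2)"
proof -
  note ac = field_hom_to_ac
  have h: "field_hom (\<lambda>q. to_ac (of_rat q :: 'k))"
    by (simp add: field_hom_def of_rat_add of_rat_mult)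
  have lie: "lie_algebra B"
    unfolding B_def by (rule ext_bracket_lie_algebra[OF field_hom_of_rat split_simple_lie]) fact
  let ?BL = "ext_bracket to_ac B"
  \<comment> \<open>The extension from the rationals through K to the closure is a single extension
    of the rational form, to which the centroid and Casimir results apply.\<close>
  have BL: "?BL = ext_bracket (\<lambda>q. to_ac (of_rat q)) B0"
    unfolding B_def by (rule ext_bracket_ext_bracket[OF ac field_hom_of_rat])
  interpret L: casimir_lie_algebra ?BL "ext_vec to_ac \<Omega>"
    unfolding BL \<Omega>_def ext_vec_ext_vec
    by (rule split_simple_ext_casimir_lie_algebra[OF h]) fact
  interpret descent: galois_descent B u B' j
  proof
    show "u \<gamma> \<in> lie_aut ?BL" if "\<gamma> \<in> GalK" for \<gamma>
      using \<open>gal_cocycle B u\<close> GalK_topspace[OF that]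
      by (auto simp: gal_cocycle_def continuous_map_def)
  qed (fact lie assms)+
  have sym: "rbar + flip rbar = to_ac c *s ext_vec to_ac \<Omega>"
    unfolding rbar_def ext_vec_flip[OF ac, symmetric] ext_vec_add[OF ac, symmetric]
      ext_vec_scale[OF ac, symmetric] \<open>r + flip r = c *s \<Omega>\<close> ..
  have cyb: "CYB ?BL rbar = 0"
    using \<open>r_matrix B \<Omega> r\<close>
    by (simp add: rbar_def CYB_ext[OF ac lie] r_matrix_def ext_vec_zero[OF ac])
  have \<delta>_eq: "ext_lin to_ac \<delta> x = ad2 ?BL x rbar" for x
    unfolding \<delta>_def rbar_def by (rule ext_lin_coboundary[OF ac lie])
  \<comment> \<open>\<alpha>\<delta> is the coboundary of \<alpha>r, which satisfies the hypotheses
    on \<open>r\<close> with \<alpha>c in place of c.\<close>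
  have bi: "lie_bialgebra ?BL (\<lambda>x. \<alpha> *s ad2 ?BL x rbar)"
  proof -
    have "\<alpha> *s rbar + flip (\<alpha> *s rbar) = (\<alpha> * to_ac c) *s ext_vec to_ac \<Omega>"
      unfolding flip_scale vec.scale_right_distrib[symmetric] sym by simp
    moreover have "CYB ?BL (\<alpha> *s rbar) = 0"
      by (simp add: CYB_scale[OF L.lie] cyb)
    ultimately have "lie_bialgebra ?BL (\<lambda>x. ad2 ?BL x (\<alpha> *s rbar))"
      by (rule L.coboundary_lie_bialgebra)
    then show ?thesis by (simp add: ad2_scale[OF L.lie])
  qed
  have "descends B' j ?BL (\<lambda>x. \<alpha> *s ext_lin to_ac \<delta> x) \<longleftrightarrow>
    (\<forall>\<gamma>\<in>GalK. \<forall>x. \<gamma> \<alpha> *s ad2 ?BL x (tens_map (u \<gamma>) (u \<gamma>) rbar) = \<alpha> *s ad2 ?BL x rbar)"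
    unfolding \<delta>_eq using descent.descends_iff[OF bi[unfolded rbar_def]] by (simp only: rbar_def)
  also have "\<dots> \<longleftrightarrow> (\<forall>\<gamma>\<in>GalK. (\<gamma> \<alpha> = \<alpha> \<and> tens_map (u \<gamma>) (u \<gamma>) rbar = rbar) \<or>
      (\<gamma> \<alpha> = - \<alpha> \<and> tens_map (u \<gamma>) (u \<gamma>) rbar = flip rbar))"
  proof (rule ball_cong[OF refl])
    fix \<gamma> :: "'k alg_closure \<Rightarrow> 'k alg_closure" assume \<gamma>: "\<gamma> \<in> GalK"
    show "(\<forall>x. \<gamma> \<alpha> *s ad2 ?BL x (tens_map (u \<gamma>) (u \<gamma>) rbar) = \<alpha> *s ad2 ?BL x rbar) \<longleftrightarrow>
        (\<gamma> \<alpha> = \<alpha> \<and> tens_map (u \<gamma>) (u \<gamma>) rbar = rbar) \<or>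
        (\<gamma> \<alpha> = - \<alpha> \<and> tens_map (u \<gamma>) (u \<gamma>) rbar = flip rbar)"
      by (rule L.invariant_iff[OF sym _ cyb descent.u_aut[OF \<gamma>] \<open>\<alpha> \<noteq> 0\<close>]) (simp add: \<open>c \<noteq> 0\<close>)
  qed
  also have "\<dots> \<longleftrightarrow> cond1 \<or> cond2"
    unfolding cond1_def cond2_def Kx_def by (rule sign_character_iff[OF \<open>\<alpha> \<noteq> 0\<close>])
  \<comment> \<open>If \<alpha> lies in K, then \<alpha>^2 is a square of K, which the second
    condition excludes.\<close>
  moreover have "\<not> (cond1 \<and> cond2)"
    by (auto simp: cond1_def cond2_def)
  ultimately show ?thesis by blast
qed

end
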